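(* Let $G$ be a group and $B$ be a unital algebra. Then the map \[\chi:\mathrm{Ext}(G,B)\rightarrow H^2(G,B),\quad[A]\mapsto\chi(A),\] is a well-defined bijection.
   Context: Algebras are associative and complex. $\mathrm{Aut}(B)$ is the group of algebra automorphisms, $B^\times$ the unit group, $C_B:B^{\times}\to\mathrm{Aut}(B)$, $C_B(u)(b)=ubu^{-1}$. $C^p(G,H)$ denotes the set of normalized maps $f:G^p\to H$ (i.e. $f(g_1,\ldots,g_p)=1_H$ whenever some $g_j=1_G$). For $S\in C^1(G,\mathrm{Aut}(B))$ and $\omega\in C^2(G,B^\times)$ put $\delta_S(g,g'):=S(g)S(g')S(gg')^{-1}$ and $(d_S\omega)(g,g',g''):=S(g)(\omega(g',g''))\,\omega(g,g'g'')\,\omega(gg',g'')^{-1}\omega(g,g')^{-1}$. The set of factor systems is \[Z^2(G,B):=\{(S,\omega)\in C^1(G,\mathrm{Aut}(B))\times C^2(G,B^\times):\delta_S=C_B\circ\omega,\ d_S\omega=1\}.\] The group $C^1(G,B^\times)$ (pointwise multiplication) acts on $Z^2(G,B)$ by $h.(S,\omega):=((C_B\circ h)\cdot S,\ h\ast_S\omega)$ with $(h\ast_S\omega)(g,g'):=h(g)\,S(g)(h(g'))\,\omega(g,g')\,h(gg')^{-1}$, and $H^2(G,B):=Z^2(G,B)/C^1(G,B^\times)$ is the orbit set. A $(G,B)$-crossed product algebra is a $G$-graded unital algebra $A=\bigoplus_{g\in G}A_g$ with $A_{1_G}=B$ such that each $A_g$ contains an invertible element. Two such algebras $A,A'$ are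 equivalent if there is an algebra isomorphism $\varphi:A\to A'$ with $\varphi(A_g)=A'_g$ for all $g\in G$ and $\varphi|_B=\mathrm{id}_B$. $\mathrm{Ext}(G,B)$ is the set of equivalence classes $[A]$. Characteristic class: given a $(G,B)$-crossed product algebra $A$, choose for each $g\in G$ an invertible element $\sigma(g)\in A_g$ with $\sigma(1_G)=1_A$, and set $S(g).b:=\sigma(g)b\sigma(g)^{-1}$ and $\omega(g,g'):=\sigma(g)\sigma(g')\sigma(gg')^{-1}$. Then $(S,\omega)\in Z^2(G,B)$ and $\chi(A):=[(S,\omega)]\in H^2(G,B)$. *)

theory Defs
  imports
    Complex_Main
    "HOL-Algebra.Module"
    "HOL-Algebra.Group_Action"
begin

section \<open>Unital associative complex algebras\<close>

text \<open>
  The library locale \<open>algebra\<close> requires commutativity, hence this variant. The zero algebra is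
  allowed.
\<close>

abbreviation complex_ring :: "complex ring"
  where "complex_ring \<equiv> \<lparr>carrier = UNIV, monoid.mult = (*), one = 1, zero = 0, add = (+)\<rparr>"

locale complex_algebra =
  Module.module complex_ring B + Ring.ring B
  for B :: "(complex, 'b, 'n) module_scheme" (structure) +
  assumes smult_mult_left:
      "\<lbrakk>x \<in> carrier B; y \<in> carrier B\<rbrakk> \<Longrightarrow> (c \<odot> x) \<otimes> y = c \<odot> (x \<otimes> y)"
    and smult_mult_right:
      "\<lbrakk>x \<in> carrier B; y \<in> carrier B\<rbrakk> \<Longrightarrow> x \<otimes> (c \<odot> y) = c \<odot> (x \<otimes> y)"

definition alg_hom ::
    "(complex, 'a, 'm) module_scheme \<Rightarrow> (complex, 'b, 'n) module_scheme \<Rightarrow> ('a \<Rightarrow> 'b) set"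
  where "alg_hom A A' =
    {f \<in> ring_hom A A'. \<forall>c. \<forall>x\<in>carrier A. f (c \<odot>\<^bsub>A\<^esub> x) = c \<odot>\<^bsub>A'\<^esub> f x}"

definition alg_iso ::
    "(complex, 'a, 'm) module_scheme \<Rightarrow> (complex, 'b, 'n) module_scheme \<Rightarrow> ('a \<Rightarrow> 'b) set"
  where "alg_iso A A' = {f \<in> alg_hom A A'. bij_betw f (carrier A) (carrier A')}"

definition Aut :: "(complex, 'b, 'n) module_scheme \<Rightarrow> ('b \<Rightarrow> 'b) monoid"
  where "Aut B = BijGroup (carrier B) \<lparr>carrier := alg_iso B B \<inter> extensional (carrier B)\<rparr>"

definition conj_aut :: "(complex, 'b, 'n) module_scheme \<Rightarrow> 'b \<Rightarrow> 'b \<Rightarrow> 'b"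
  where "conj_aut B u = (\<lambda>b\<in>carrier B. u \<otimes>\<^bsub>B\<^esub> b \<otimes>\<^bsub>B\<^esub> inv\<^bsub>B\<^esub> u)"


section \<open>Factor systems and the second cohomology set\<close>

text \<open>All cochains are extensional, so that equality of functions is equality on the carrier.\<close>

definition C1 :: "('g, 'm) monoid_scheme \<Rightarrow> ('h, 'n) monoid_scheme \<Rightarrow> ('g \<Rightarrow> 'h) set"
  where "C1 G H = {f \<in> carrier G \<rightarrow>\<^sub>E carrier H. f \<one>\<^bsub>G\<^esub> = \<one>\<^bsub>H\<^esub>}"

definition C2 :: "('g, 'm) monoid_scheme \<Rightarrow> ('h, 'n) monoid_scheme \<Rightarrow> ('g \<times> 'g \<Rightarrow> 'h) set"
  where "C2 G H = {f \<in> carrier G \<times> carrier G \<rightarrow>\<^sub>E carrier H.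
    \<forall>g\<in>carrier G. f (g, \<one>\<^bsub>G\<^esub>) = \<one>\<^bsub>H\<^esub> \<and> f (\<one>\<^bsub>G\<^esub>, g) = \<one>\<^bsub>H\<^esub>}"

definition delta ::
    "('g, 'm) monoid_scheme \<Rightarrow> (complex, 'b, 'n) module_scheme \<Rightarrow> ('g \<Rightarrow> 'b \<Rightarrow> 'b)
      \<Rightarrow> 'g \<Rightarrow> 'g \<Rightarrow> 'b \<Rightarrow> 'b"
  where "delta G B S g g' =
    S g \<otimes>\<^bsub>Aut B\<^esub> S g' \<otimes>\<^bsub>Aut B\<^esub> inv\<^bsub>Aut B\<^esub> (S (g \<otimes>\<^bsub>G\<^esub> g'))"

definition dS ::
    "('g, 'm) monoid_scheme \<Rightarrow> (complex, 'b, 'n) module_scheme \<Rightarrow> ('g \<Rightarrow> 'b \<Rightarrow> 'b)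
      \<Rightarrow> ('g \<times> 'g \<Rightarrow> 'b) \<Rightarrow> 'g \<Rightarrow> 'g \<Rightarrow> 'g \<Rightarrow> 'b"
  where "dS G B S \<omega> g g' g'' =
    S g (\<omega> (g', g'')) \<otimes>\<^bsub>B\<^esub> \<omega> (g, g' \<otimes>\<^bsub>G\<^esub> g'')
      \<otimes>\<^bsub>B\<^esub> inv\<^bsub>B\<^esub> (\<omega> (g \<otimes>\<^bsub>G\<^esub> g', g'')) \<otimes>\<^bsub>B\<^esub> inv\<^bsub>B\<^esub> (\<omega> (g, g'))"

definition Z2 ::
    "('g, 'm) monoid_scheme \<Rightarrow> (complex, 'b, 'n) module_scheme
      \<Rightarrow> (('g \<Rightarrow> 'b \<Rightarrow> 'b) \<times> ('g \<times> 'g \<Rightarrow> 'b)) set"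
  where "Z2 G B = {(S, \<omega>). S \<in> C1 G (Aut B) \<and> \<omega> \<in> C2 G (units_of B) \<and>
    (\<forall>g\<in>carrier G. \<forall>g'\<in>carrier G. delta G B S g g' = conj_aut B (\<omega> (g, g'))) \<and>
    (\<forall>g\<in>carrier G. \<forall>g'\<in>carrier G. \<forall>g''\<in>carrier G. dS G B S \<omega> g g' g'' = \<one>\<^bsub>B\<^esub>)}"

definition C1_group ::
    "('g, 'm) monoid_scheme \<Rightarrow> (complex, 'b, 'n) module_scheme \<Rightarrow> ('g \<Rightarrow> 'b) monoid"
  where "C1_group G B =
    \<lparr>carrier = C1 G (units_of B),
     monoid.mult = (\<lambda>h k. \<lambda>g\<in>carrier G. h g \<otimes>\<^bsub>B\<^esub> k g),
     one = (\<lambda>g\<in>carrier G. \<one>\<^bsub>B\<^esub>)\<rparr>"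

definition Z2_act ::
    "('g, 'm) monoid_scheme \<Rightarrow> (complex, 'b, 'n) module_scheme \<Rightarrow> ('g \<Rightarrow> 'b)
      \<Rightarrow> ('g \<Rightarrow> 'b \<Rightarrow> 'b) \<times> ('g \<times> 'g \<Rightarrow> 'b) \<Rightarrow> ('g \<Rightarrow> 'b \<Rightarrow> 'b) \<times> ('g \<times> 'g \<Rightarrow> 'b)"
  where "Z2_act G B h = (\<lambda>(S, \<omega>)\<in>Z2 G B.
    (\<lambda>g\<in>carrier G. conj_aut B (h g) \<otimes>\<^bsub>Aut B\<^esub> S g,
     \<lambda>(g, g')\<in>carrier G \<times> carrier G.
       h g \<otimes>\<^bsub>B\<^esub> S g (h g') \<otimes>\<^bsub>B\<^esub> \<omega> (g, g') \<otimes>\<^bsub>B\<^esub> inv\<^bsub>B\<^esub> (h (g \<otimes>\<^bsub>G\<^esub> g'))))"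

definition coh_class ::
    "('g, 'm) monoid_scheme \<Rightarrow> (complex, 'b, 'n) module_scheme
      \<Rightarrow> ('g \<Rightarrow> 'b \<Rightarrow> 'b) \<times> ('g \<times> 'g \<Rightarrow> 'b) \<Rightarrow> (('g \<Rightarrow> 'b \<Rightarrow> 'b) \<times> ('g \<times> 'g \<Rightarrow> 'b)) set"
  where "coh_class G B z = orbit (C1_group G B) (Z2_act G B) z"

definition H2 ::
    "('g, 'm) monoid_scheme \<Rightarrow> (complex, 'b, 'n) module_scheme
      \<Rightarrow> (('g \<Rightarrow> 'b \<Rightarrow> 'b) \<times> ('g \<times> 'g \<Rightarrow> 'b)) set set"
  where "H2 G B = orbits (C1_group G B) (Z2 G B) (Z2_act G B)"


section \<open>Crossed product algebras\<close>

text \<open>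
  A \<open>G\<close>-graded algebra together with the identification of \<open>B\<close> with the component of degree
  \<open>\<one>\<close>. Since \<open>B\<close> and the graded algebra live on different types, the identity \<open>A\<^sub>1 = B\<close> is
  expressed by an algebra homomorphism \<open>base\<close> that maps \<open>B\<close> bijectively onto \<open>A\<^sub>1\<close>.
\<close>

record ('g, 'b, 'a) graded_alg =
  total :: "(complex, 'a) module"
  component :: "'g \<Rightarrow> 'a set"
  base :: "'b \<Rightarrow> 'a"

definition direct_sum_decomp ::
    "(complex, 'a, 'm) module_scheme \<Rightarrow> 'g set \<Rightarrow> ('g \<Rightarrow> 'a set) \<Rightarrow> bool"
  where "direct_sum_decomp A I M \<longleftrightarrow>
    (\<forall>i\<in>I. submodule (M i) complex_ring A) \<and>
    (\<forall>a\<in>carrier A. \<exists>!f. f \<in> (\<Pi>\<^sub>E i\<in>I. M i) \<and> finite {i \<in> I. f i \<noteq> \<zero>\<^bsub>A\<^esub>} \<and>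
      a = finsum A f {i \<in> I. f i \<noteq> \<zero>\<^bsub>A\<^esub>})"

definition crossed_products ::
    "('g, 'm) monoid_scheme \<Rightarrow> (complex, 'b, 'n) module_scheme \<Rightarrow> ('g, 'b, 'a) graded_alg set"
  where "crossed_products G B = {X.
    complex_algebra (total X) \<and>
    direct_sum_decomp (total X) (carrier G) (component X) \<and>
    (\<forall>g\<in>carrier G. \<forall>h\<in>carrier G. \<forall>x\<in>component X g. \<forall>y\<in>component X h.
      x \<otimes>\<^bsub>total X\<^esub> y \<in> component X (g \<otimes>\<^bsub>G\<^esub> h)) \<and>
    base X \<in> alg_hom B (total X) \<and>
    bij_betw (base X) (carrier B) (component X \<one>\<^bsub>G\<^esub>) \<and>
    (\<forall>g\<in>carrier G. component X g \<inter> Units (total X) \<noteq> {})}"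

definition cp_equiv ::
    "('g, 'm) monoid_scheme \<Rightarrow> (complex, 'b, 'n) module_scheme
      \<Rightarrow> ('g, 'b, 'a) graded_alg \<Rightarrow> ('g, 'b, 'c) graded_alg \<Rightarrow> bool"
  where "cp_equiv G B X Y \<longleftrightarrow> (\<exists>\<phi>\<in>alg_iso (total X) (total Y).
    (\<forall>g\<in>carrier G. \<phi> ` component X g = component Y g) \<and>
    (\<forall>b\<in>carrier B. \<phi> (base X b) = base Y b))"

definition ext_rel ::
    "('g, 'm) monoid_scheme \<Rightarrow> (complex, 'b, 'n) module_scheme
      \<Rightarrow> (('g, 'b, 'a) graded_alg \<times> ('g, 'b, 'a) graded_alg) set"
  where "ext_rel G B =
    {(X, Y). X \<in> crossed_products G B \<and> Y \<in> crossed_products G B \<and> cp_equiv G B X Y}"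

definition Ext ::
    "('g, 'm) monoid_scheme \<Rightarrow> (complex, 'b, 'n) module_scheme
      \<Rightarrow> ('g, 'b, 'a) graded_alg set set"
  where "Ext G B = crossed_products G B // ext_rel G B"


section \<open>The characteristic class\<close>

definition sections :: "('g, 'm) monoid_scheme \<Rightarrow> ('g, 'b, 'a) graded_alg \<Rightarrow> ('g \<Rightarrow> 'a) set"
  where "sections G X =
    {\<sigma> \<in> (\<Pi>\<^sub>E g\<in>carrier G. component X g \<inter> Units (total X)). \<sigma> \<one>\<^bsub>G\<^esub> = \<one>\<^bsub>total X\<^esub>}"

definition factor_system ::
    "('g, 'm) monoid_scheme \<Rightarrow> (complex, 'b, 'n) module_scheme \<Rightarrow> ('g, 'b, 'a) graded_alg
      \<Rightarrow> ('g \<Rightarrow> 'a) \<Rightarrow> ('g \<Rightarrow> 'b \<Rightarrow> 'b) \<times> ('g \<times> 'g \<Rightarrow> 'b)"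
  where "factor_system G B X \<sigma> =
    (\<lambda>g\<in>carrier G. \<lambda>b\<in>carrier B. inv_into (carrier B) (base X)
       (\<sigma> g \<otimes>\<^bsub>total X\<^esub> base X b \<otimes>\<^bsub>total X\<^esub> inv\<^bsub>total X\<^esub> (\<sigma> g)),
     \<lambda>(g, g')\<in>carrier G \<times> carrier G. inv_into (carrier B) (base X)
       (\<sigma> g \<otimes>\<^bsub>total X\<^esub> \<sigma> g' \<otimes>\<^bsub>total X\<^esub> inv\<^bsub>total X\<^esub> (\<sigma> (g \<otimes>\<^bsub>G\<^esub> g'))))"

text \<open>
  \<open>the_elem\<close> yields the common value of the classes over all choices of \<open>\<sigma>\<close>, respectively of
  the representative; that these values do coincide is part of the theorem.
\<close>

definition char_class ::
    "('g, 'm) monoid_scheme \<Rightarrow> (complex, 'b, 'n) module_scheme \<Rightarrow> ('g, 'b, 'a) graded_alg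
      \<Rightarrow> (('g \<Rightarrow> 'b \<Rightarrow> 'b) \<times> ('g \<times> 'g \<Rightarrow> 'b)) set"
  where "char_class G B X =
    the_elem ((\<lambda>\<sigma>. coh_class G B (factor_system G B X \<sigma>)) ` sections G X)"

definition char_map ::
    "('g, 'm) monoid_scheme \<Rightarrow> (complex, 'b, 'n) module_scheme \<Rightarrow> ('g, 'b, 'a) graded_alg set
      \<Rightarrow> (('g \<Rightarrow> 'b \<Rightarrow> 'b) \<times> ('g \<times> 'g \<Rightarrow> 'b)) set"
  where "char_map G B E = the_elem (char_class G B ` E)"

end

theory Submission
  imports Defs
begin

text \<open>
  For a section \<open>\<sigma>\<close> of a crossed product \<open>A\<close> every element is uniquely a finite sum of terms
  \<open>b \<sigma>(g)\<close>, and these multiply by \<open>b \<sigma>(g) c \<sigma>(h) = b S(g)(c) \<omega>(g, h) \<sigma>(gh)\<close>. Hence \<open>A\<close> is equivalent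
  to the algebra of finitely supported functions \<open>G \<rightarrow> B\<close> with the product twisted by \<open>(S, \<omega>)\<close>; for
  any factor system that product is associative, and the monomials \<open>1 g\<close> form a section with factor
  system \<open>(S, \<omega>)\<close>. The sections of \<open>A\<close> are exactly the \<open>h \<sigma>\<close> with \<open>h\<close> in \<open>C\<^sup>1(G, B\<^sup>\<times>)\<close>, and the factor
  system of \<open>h \<sigma>\<close> is \<open>h.(S, \<omega>)\<close>. So the class of \<open>(S, \<omega>)\<close> is simply the set of all factor systems
  of \<open>A\<close>; neither the independence of \<open>\<sigma>\<close> nor the injectivity needs any cocycle computation.
\<close>

section \<open>Homomorphisms and automorphisms of complex algebras\<close>

text \<open>A component is only required to contain some unit of \<open>A\<close>; nothing says that
  its inverse is homogeneous. That a unit of degree \<open>g\<close> has its inverse in degree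
  \<open>inv g\<close> (\<open>inv_component\<close>) is what places
  \<open>\<sigma> g b inv (\<sigma> g)\<close> and
  \<open>\<sigma> g \<sigma> h inv (\<sigma> (g h))\<close> in the component of degree one, so that
  they can be pulled back to \<open>B\<close> along \<open>base\<close>. Identities between elements
  of \<open>B\<close> are then verified in \<open>A\<close> after right multiplication by some
  \<open>\<sigma> g\<close>, which can be cancelled. In this form a factor system is characterised
  by equations such as \<open>S g b \<sigma> g = \<sigma> g b\<close>, which contain no inverses and
  are preserved by algebra homomorphisms. Crossed products with equal classes share a factor system,
  so both are equivalent to one and the same twisted algebra; conversely, an equivalence carries
  sections to sections with the same factor system. Since every twisted algebra has carrier type
  \<open>'g \<Rightarrow> 'b\<close>, forming \<open>Ext\<close> over this single type loses no
  equivalence class.\<close>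

lemma alg_hom_simps:
  assumes "f \<in> alg_hom A A'"
  shows "x \<in> carrier A \<Longrightarrow> f x \<in> carrier A'"
    and "\<lbrakk>x \<in> carrier A; y \<in> carrier A\<rbrakk> \<Longrightarrow> f (x \<otimes>\<^bsub>A\<^esub> y) = f x \<otimes>\<^bsub>A'\<^esub> f y"
    and "\<lbrakk>x \<in> carrier A; y \<in> carrier A\<rbrakk> \<Longrightarrow> f (x \<oplus>\<^bsub>A\<^esub> y) = f x \<oplus>\<^bsub>A'\<^esub> f y"
    and "f \<one>\<^bsub>A\<^esub> = \<one>\<^bsub>A'\<^esub>"
    and "x \<in> carrier A \<Longrightarrow> f (c \<odot>\<^bsub>A\<^esub> x) = c \<odot>\<^bsub>A'\<^esub> f x"
  using assms by (auto simp: alg_hom_def ring_hom_def)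

lemma alg_homI:
  assumes "\<And>x. x \<in> carrier A \<Longrightarrow> f x \<in> carrier A'"
    and "\<And>x y. \<lbrakk>x \<in> carrier A; y \<in> carrier A\<rbrakk> \<Longrightarrow> f (x \<otimes>\<^bsub>A\<^esub> y) = f x \<otimes>\<^bsub>A'\<^esub> f y"
    and "\<And>x y. \<lbrakk>x \<in> carrier A; y \<in> carrier A\<rbrakk> \<Longrightarrow> f (x \<oplus>\<^bsub>A\<^esub> y) = f x \<oplus>\<^bsub>A'\<^esub> f y"
    and "f \<one>\<^bsub>A\<^esub> = \<one>\<^bsub>A'\<^esub>"
    and "\<And>c x. x \<in> carrier A \<Longrightarrow> f (c \<odot>\<^bsub>A\<^esub> x) = c \<odot>\<^bsub>A'\<^esub> f x"
  shows "f \<in> alg_hom A A'"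
  using assms by (auto simp: alg_hom_def ring_hom_def)

lemma alg_hom_zero:
  assumes "f \<in> alg_hom A A'" "complex_algebra A" "complex_algebra A'"
  shows "f \<zero>\<^bsub>A\<^esub> = \<zero>\<^bsub>A'\<^esub>"
proof -
  interpret A: complex_algebra A by fact
  interpret A': complex_algebra A' by fact
  have "f \<in> ring_hom A A'"
    using assms(1) by (simp add: alg_hom_def)
  then show ?thesis
    by (rule ring_hom_zero[OF _ A.ring_axioms A'.ring_axioms])
qed

lemma alg_hom_finsum:
  assumes f: "f \<in> alg_hom A A'" and "complex_algebra A" "complex_algebra A'"
    and x: "x \<in> F \<rightarrow> carrier A"
  shows "f (finsum A x F) = finsum A' (\<lambda>i. f (x i)) F"
proof -
  interpret A: complex_algebra A by fact
  interpret A': complex_algebra A' by fact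
  show ?thesis using x
  \<comment> \<open>For infinite \<open>F\<close> both sums are zero by convention, so the identity
    holds without a finiteness condition.\<close>
  proof (induction F rule: infinite_finite_induct)
    case (insert i F)
    then have "x \<in> F \<rightarrow> carrier A" "x i \<in> carrier A" by auto
    moreover from this have "(\<lambda>i. f (x i)) \<in> F \<rightarrow> carrier A'" "f (x i) \<in> carrier A'"
      using alg_hom_simps(1)[OF f] by auto
    ultimately show ?case using insert
      by (simp add: A.finsum_insert A'.finsum_insert alg_hom_simps(3)[OF f])
  qed (use alg_hom_zero[OF assms(1-3)] in simp_all)
qed

lemma alg_isoD:
  assumes "f \<in> alg_iso A A'"
  shows "f \<in> alg_hom A A'" "bij_betw f (carrier A) (carrier A')" "inj_on f (carrier A)"
    "f ` carrier A = carrier A'"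
  using assms by (auto simp: alg_iso_def bij_betw_def)

lemma alg_hom_comp:
  "\<lbrakk>f \<in> alg_hom A A'; f' \<in> alg_hom A' A''\<rbrakk> \<Longrightarrow> f' \<circ> f \<in> alg_hom A A''"
  by (auto simp: alg_hom_def ring_hom_def Pi_iff)

lemma alg_iso_comp:
  "\<lbrakk>f \<in> alg_iso A A'; f' \<in> alg_iso A' A''\<rbrakk> \<Longrightarrow> f' \<circ> f \<in> alg_iso A A''"
  by (auto simp: alg_iso_def alg_hom_comp intro: bij_betw_trans)

lemma alg_iso_inv:
  assumes f: "f \<in> alg_iso A A'" and "complex_algebra A"
  shows "inv_into (carrier A) f \<in> alg_iso A' A"
proof -
  interpret A: complex_algebra A by fact
  let ?k = "inv_into (carrier A) f"
  note D = alg_isoD[OF f] and S = alg_hom_simps[OF alg_isoD(1)[OF f]]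
  have k: "?k y \<in> carrier A" "f (?k y) = y" if "y \<in> carrier A'" for y
    using that D(4) by (auto simp: inv_into_into f_inv_into_f)
  have eq: "?k y = x" if "x \<in> carrier A" "f x = y" for x y
    using that D(3) by auto
  have "?k \<in> alg_hom A' A"
  proof (rule alg_homI)
    fix x y assume xy: "x \<in> carrier A'" "y \<in> carrier A'"
    show "?k (x \<otimes>\<^bsub>A'\<^esub> y) = ?k x \<otimes>\<^bsub>A\<^esub> ?k y"
      by (rule eq) (use xy k S in auto)
    show "?k (x \<oplus>\<^bsub>A'\<^esub> y) = ?k x \<oplus>\<^bsub>A\<^esub> ?k y"
      by (rule eq) (use xy k S in auto)
  next
    fix c x assume x: "x \<in> carrier A'"
    show "?k (c \<odot>\<^bsub>A'\<^esub> x) = c \<odot>\<^bsub>A\<^esub> ?k x"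
      by (rule eq) (use x k S in auto)
  next
    show "?k \<one>\<^bsub>A'\<^esub> = \<one>\<^bsub>A\<^esub>"
      by (rule eq) (use S in auto)
  qed (rule k)
  then show ?thesis
    using D(2) by (simp add: alg_iso_def bij_betw_inv_into)
qed

lemma alg_iso_id: "id \<in> alg_iso A A"
  by (auto simp: alg_iso_def alg_hom_def ring_hom_def)

text \<open>Elements of \<open>Aut B\<close> are extensional, whereas composites and
  \<open>inv_into\<close> need not be; restriction brings them back into \<open>Aut B\<close>
  without changing them on the carrier.\<close>

lemma alg_iso_restrict:
  assumes "f \<in> alg_iso A A" "complex_algebra A"
  shows "restrict f (carrier A) \<in> alg_iso A A"
proof -
  interpret A: complex_algebra A by fact
  have "bij_betw (restrict f (carrier A)) (carrier A) (carrier A)"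
    using alg_isoD(2)[OF assms(1)] by (simp cong: bij_betw_cong)
  then show ?thesis using assms(1)
    by (auto simp: alg_iso_def alg_hom_def ring_hom_def)
qed

lemma alg_hom_Units:
  assumes "f \<in> alg_hom A A'" "u \<in> Units A"
  shows "f u \<in> Units A'"
proof -
  from assms(2) obtain v where "u \<in> carrier A" "v \<in> carrier A" "v \<otimes>\<^bsub>A\<^esub> u = \<one>\<^bsub>A\<^esub>" "u \<otimes>\<^bsub>A\<^esub> v = \<one>\<^bsub>A\<^esub>"
    unfolding Units_def by blast
  then have "f u \<in> carrier A'" "f v \<in> carrier A'"
     "f v \<otimes>\<^bsub>A'\<^esub> f u = \<one>\<^bsub>A'\<^esub>" "f u \<otimes>\<^bsub>A'\<^esub> f v = \<one>\<^bsub>A'\<^esub>"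
    using alg_hom_simps[OF assms(1)] by metis+
  then show ?thesis unfolding Units_def by blast
qed

section \<open>The automorphism group and conjugation by units\<close>

context complex_algebra
begin

lemma Aut_carrier: "carrier (Aut B) = alg_iso B B \<inter> extensional (carrier B)"
  by (simp add: Aut_def)

lemma Aut_one: "\<one>\<^bsub>Aut B\<^esub> = (\<lambda>b\<in>carrier B. b)"
  by (simp add: Aut_def BijGroup_def)

lemma Aut_mult:
  assumes "f \<in> carrier (Aut B)" "f' \<in> carrier (Aut B)"
  shows "f \<otimes>\<^bsub>Aut B\<^esub> f' = compose (carrier B) f f'"
  using assms by (simp add: Aut_def BijGroup_def Bij_def alg_iso_def)

lemma Aut_compose_closed:
  assumes "f \<in> carrier (Aut B)" "f' \<in> carrier (Aut B)"
  shows "compose (carrier B) f f' \<in> carrier (Aut B)"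
proof -
  have "compose (carrier B) f f' = restrict (f \<circ> f') (carrier B)"
    by (auto simp: compose_def)
  then show ?thesis
    using assms alg_iso_restrict[OF alg_iso_comp complex_algebra_axioms] by (auto simp: Aut_carrier)
qed

lemma Aut_one_closed: "(\<lambda>b\<in>carrier B. b) \<in> carrier (Aut B)"
  using alg_iso_restrict[OF alg_iso_id complex_algebra_axioms] by (auto simp: Aut_carrier id_def)

text \<open>The group laws give meaning to the inverse occurring in \<open>delta\<close> and allow
  solving for it in \<open>delta_eq_iff\<close>.\<close>

lemma Aut_group: "group (Aut B)"
proof (rule groupI)
  show "f \<otimes>\<^bsub>Aut B\<^esub> f' \<in> carrier (Aut B)" if "f \<in> carrier (Aut B)" "f' \<in> carrier (Aut B)" for f f'
    using that by (simp add: Aut_mult Aut_compose_closed)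
  show "\<one>\<^bsub>Aut B\<^esub> \<in> carrier (Aut B)"
    by (simp add: Aut_one Aut_one_closed)
next
  fix f f' f'' assume f: "f \<in> carrier (Aut B)" "f' \<in> carrier (Aut B)" "f'' \<in> carrier (Aut B)"
  then have "f'' \<in> carrier B \<rightarrow> carrier B"
    by (auto simp: Aut_carrier alg_iso_def alg_hom_simps)
  then show "f \<otimes>\<^bsub>Aut B\<^esub> f' \<otimes>\<^bsub>Aut B\<^esub> f'' = f \<otimes>\<^bsub>Aut B\<^esub> (f' \<otimes>\<^bsub>Aut B\<^esub> f'')"
    using f Aut_compose_closed by (simp add: Aut_mult compose_assoc)
next
  fix f assume f: "f \<in> carrier (Aut B)"
  then have fc: "f \<in> carrier B \<rightarrow> carrier B" "f \<in> extensional (carrier B)" "f \<in> alg_iso B B"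
    by (auto simp: Aut_carrier alg_iso_def alg_hom_simps)
  show "\<one>\<^bsub>Aut B\<^esub> \<otimes>\<^bsub>Aut B\<^esub> f = f"
    using f Aut_one_closed fc by (simp add: Aut_one Aut_mult Id_compose)
  let ?k = "restrict (inv_into (carrier B) f) (carrier B)"
  have "?k \<in> carrier (Aut B)"
    using alg_iso_restrict[OF alg_iso_inv] fc complex_algebra_axioms by (auto simp: Aut_carrier)
  moreover have "compose (carrier B) ?k f = (\<lambda>b\<in>carrier B. b)"
    by (rule compose_inv_into_id) (rule alg_isoD[OF fc(3)])
  ultimately show "\<exists>k\<in>carrier (Aut B). k \<otimes>\<^bsub>Aut B\<^esub> f = \<one>\<^bsub>Aut B\<^esub>"
    using f by (intro bexI[of _ ?k]) (simp_all add: Aut_mult Aut_one)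
qed

end

declare (in complex_algebra) Units_closed [simp]

lemma (in complex_algebra) conj_aut_Aut:
  assumes u: "u \<in> Units B"
  shows "conj_aut B u \<in> carrier (Aut B)"
proof -
  let ?f = "\<lambda>v b. v \<otimes> b \<otimes> inv v"
  have closed: "?f v b \<in> carrier B" if "v \<in> Units B" "b \<in> carrier B" for v b
    using that by simp
  have inv: "?f (inv v) (?f v b) = b" if "v \<in> Units B" "b \<in> carrier B" for v b
  proof -
    have "?f (inv v) (?f v b) = (inv v \<otimes> v) \<otimes> b \<otimes> (inv v \<otimes> v)"
      using that by (simp add: m_assoc del: Units_l_inv Units_r_inv)
    then show ?thesis using that by simp
  qed
  have hom: "?f u \<in> alg_hom B B"
  proof (rule alg_homI)
    fix x y assume xy: "x \<in> carrier B" "y \<in> carrier B"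
    have "?f u x \<otimes> ?f u y = u \<otimes> x \<otimes> (inv u \<otimes> u) \<otimes> y \<otimes> inv u"
      using u xy by (simp add: m_assoc del: Units_l_inv Units_r_inv)
    then show "?f u (x \<otimes> y) = ?f u x \<otimes> ?f u y"
      using u xy by (simp add: m_assoc)
    show "?f u (x \<oplus> y) = ?f u x \<oplus> ?f u y"
      using u xy by (simp add: l_distr r_distr)
  qed (use u in \<open>simp_all add: smult_mult_left smult_mult_right\<close>)
  have "bij_betw (?f u) (carrier B) (carrier B)"
    by (rule bij_betw_byWitness[where f' = "?f (inv u)"])
      (use u inv[of u] inv[of "inv u"] in \<open>auto simp: Units_inv_inv\<close>)
  with hom have "?f u \<in> alg_iso B B"
    by (simp add: alg_iso_def)
  from alg_iso_restrict[OF this complex_algebra_axioms] show ?thesis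
    by (simp add: Aut_carrier conj_aut_def)
qed

section \<open>Factor systems\<close>

locale group_alg =
  G: group G + B: complex_algebra B
  for G :: "('g, 'm) monoid_scheme" and B :: "(complex, 'b, 'n) module_scheme"
begin

text \<open>Both \<open>S (g h)\<close> in \<open>Aut B\<close> and \<open>u\<close> in
  \<open>B\<close> are invertible, so each inverse can be moved to the other side. What remains is a
  pointwise identity inside \<open>B\<close>, the rule for moving \<open>u\<close> past a value of
  \<open>S\<close>.\<close>

lemma delta_eq_iff:
  assumes S: "S \<in> carrier G \<rightarrow> carrier (Aut B)" and u: "u \<in> Units B"
    and g: "g \<in> carrier G" "h \<in> carrier G"
  shows "delta G B S g h = conj_aut B u \<longleftrightarrow>
    (\<forall>b\<in>carrier B. S g (S h b) \<otimes>\<^bsub>B\<^esub> u = u \<otimes>\<^bsub>B\<^esub> S (g \<otimes>\<^bsub>G\<^esub> h) b)"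
proof -
  interpret A: group "Aut B" by (rule B.Aut_group)
  let ?gh = "g \<otimes>\<^bsub>G\<^esub> h"
  have gh: "?gh \<in> carrier G" using g by simp
  have Sc: "S k \<in> carrier (Aut B)" if "k \<in> carrier G" for k
    using S that by auto
  have Sb: "S k b \<in> carrier B" if "k \<in> carrier G" "b \<in> carrier B" for k b
    using Sc[OF that(1)] that(2) by (auto simp: B.Aut_carrier alg_iso_def alg_hom_simps)
  note c = Sc[OF g(1)] Sc[OF g(2)] Sc[OF gh] B.conj_aut_Aut[OF u]
  have "delta G B S g h = conj_aut B u \<longleftrightarrow>
      S g \<otimes>\<^bsub>Aut B\<^esub> S h = conj_aut B u \<otimes>\<^bsub>Aut B\<^esub> S ?gh"
    unfolding delta_def using c by (metis A.inv_solve_right A.m_closed)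
  also have "\<dots> \<longleftrightarrow> (\<forall>b\<in>carrier B. S g (S h b) = u \<otimes>\<^bsub>B\<^esub> S ?gh b \<otimes>\<^bsub>B\<^esub> inv\<^bsub>B\<^esub> u)"
    using c Sb[OF gh] by (force simp: B.Aut_mult compose_def conj_aut_def fun_eq_iff restrict_def)
  also have "\<dots> \<longleftrightarrow> (\<forall>b\<in>carrier B. S g (S h b) \<otimes>\<^bsub>B\<^esub> u = u \<otimes>\<^bsub>B\<^esub> S ?gh b)"
  proof (intro ball_cong refl)
    fix b assume b: "b \<in> carrier B"
    let ?x = "S g (S h b)" and ?y = "u \<otimes>\<^bsub>B\<^esub> S ?gh b"
    have xy: "?x \<in> carrier B" "?y \<in> carrier B" "u \<in> carrier B" "inv\<^bsub>B\<^esub> u \<in> carrier B"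
      using Sb g gh b u by auto
    have "?x \<otimes>\<^bsub>B\<^esub> u \<otimes>\<^bsub>B\<^esub> inv\<^bsub>B\<^esub> u = ?x" "?y \<otimes>\<^bsub>B\<^esub> inv\<^bsub>B\<^esub> u \<otimes>\<^bsub>B\<^esub> u = ?y"
      using xy u by (simp_all add: B.m_assoc)
    then show "?x = ?y \<otimes>\<^bsub>B\<^esub> inv\<^bsub>B\<^esub> u \<longleftrightarrow> ?x \<otimes>\<^bsub>B\<^esub> u = ?y"
      by metis
  qed
  finally show ?thesis .
qed

text \<open>An expression \<open>a inv b inv c\<close> equals one exactly if \<open>a = c b\<close>.
  In this shape the two sides are the coefficients that arise from the two bracketings of a product
  of three monomials.\<close>

lemma dS_eq_one_iff:
  assumes x: "S g (\<omega> (h, k)) \<in> carrier B"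
    and u: "\<omega> (g, h \<otimes>\<^bsub>G\<^esub> k) \<in> Units B" "\<omega> (g \<otimes>\<^bsub>G\<^esub> h, k) \<in> Units B" "\<omega> (g, h) \<in> Units B"
  shows "dS G B S \<omega> g h k = \<one>\<^bsub>B\<^esub> \<longleftrightarrow>
    S g (\<omega> (h, k)) \<otimes>\<^bsub>B\<^esub> \<omega> (g, h \<otimes>\<^bsub>G\<^esub> k) = \<omega> (g, h) \<otimes>\<^bsub>B\<^esub> \<omega> (g \<otimes>\<^bsub>G\<^esub> h, k)"
proof -
  let ?a = "S g (\<omega> (h, k)) \<otimes>\<^bsub>B\<^esub> \<omega> (g, h \<otimes>\<^bsub>G\<^esub> k)" and ?b = "\<omega> (g \<otimes>\<^bsub>G\<^esub> h, k)" and ?c = "\<omega> (g, h)"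
  have a: "?a \<in> carrier B" using x u by simp
  note bc = B.Units_closed[OF u(2)] B.Units_closed[OF u(3)] B.Units_inv_closed[OF u(2)]
    B.Units_inv_closed[OF u(3)] B.m_assoc
  have "(?a \<otimes>\<^bsub>B\<^esub> inv\<^bsub>B\<^esub> ?b \<otimes>\<^bsub>B\<^esub> inv\<^bsub>B\<^esub> ?c) \<otimes>\<^bsub>B\<^esub> ?c \<otimes>\<^bsub>B\<^esub> ?b
      = ?a \<otimes>\<^bsub>B\<^esub> (inv\<^bsub>B\<^esub> ?b \<otimes>\<^bsub>B\<^esub> ((inv\<^bsub>B\<^esub> ?c \<otimes>\<^bsub>B\<^esub> ?c) \<otimes>\<^bsub>B\<^esub> ?b))"
    using a bc by (simp del: B.Units_l_inv B.Units_r_inv)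
  then have "?a = (?a \<otimes>\<^bsub>B\<^esub> inv\<^bsub>B\<^esub> ?b \<otimes>\<^bsub>B\<^esub> inv\<^bsub>B\<^esub> ?c) \<otimes>\<^bsub>B\<^esub> ?c \<otimes>\<^bsub>B\<^esub> ?b"
    using a bc u by simp
  moreover have "?c \<otimes>\<^bsub>B\<^esub> ?b \<otimes>\<^bsub>B\<^esub> inv\<^bsub>B\<^esub> ?b \<otimes>\<^bsub>B\<^esub> inv\<^bsub>B\<^esub> ?c = \<one>\<^bsub>B\<^esub>"
    using a bc u by simp
  ultimately show ?thesis
    unfolding dS_def using bc by (metis B.l_one)
qed

text \<open>The working form of the definition: all conditions are equations in \<open>B\<close>,
  free of inverses and of the product in \<open>Aut B\<close>. It serves both to read off the laws
  of a given factor system and to verify that a pair obtained from a section is one.\<close>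

lemma Z2_iff:
  "(S, \<omega>) \<in> Z2 G B \<longleftrightarrow>
    S \<in> carrier G \<rightarrow>\<^sub>E alg_iso B B \<inter> extensional (carrier B) \<and>
    S \<one>\<^bsub>G\<^esub> = (\<lambda>b\<in>carrier B. b) \<and>
    \<omega> \<in> carrier G \<times> carrier G \<rightarrow>\<^sub>E Units B \<and>
    (\<forall>g\<in>carrier G. \<omega> (g, \<one>\<^bsub>G\<^esub>) = \<one>\<^bsub>B\<^esub> \<and> \<omega> (\<one>\<^bsub>G\<^esub>, g) = \<one>\<^bsub>B\<^esub>) \<and>
    (\<forall>g\<in>carrier G. \<forall>h\<in>carrier G. \<forall>b\<in>carrier B.
      S g (S h b) \<otimes>\<^bsub>B\<^esub> \<omega> (g, h) = \<omega> (g, h) \<otimes>\<^bsub>B\<^esub> S (g \<otimes>\<^bsub>G\<^esub> h) b) \<and>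
    (\<forall>g\<in>carrier G. \<forall>h\<in>carrier G. \<forall>k\<in>carrier G.
      S g (\<omega> (h, k)) \<otimes>\<^bsub>B\<^esub> \<omega> (g, h \<otimes>\<^bsub>G\<^esub> k) = \<omega> (g, h) \<otimes>\<^bsub>B\<^esub> \<omega> (g \<otimes>\<^bsub>G\<^esub> h, k))"
    (is "_ \<longleftrightarrow> ?S \<and> ?S1 \<and> ?\<omega> \<and> ?\<omega>1 \<and> ?d \<and> ?c")
proof -
  have "S \<in> C1 G (Aut B) \<longleftrightarrow> ?S \<and> ?S1"
    by (auto simp: C1_def B.Aut_carrier B.Aut_one)
  moreover have "\<omega> \<in> C2 G (units_of B) \<longleftrightarrow> ?\<omega> \<and> ?\<omega>1"
    by (auto simp: C2_def units_of_carrier units_of_one)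
  moreover have "(\<forall>g\<in>carrier G. \<forall>h\<in>carrier G. delta G B S g h = conj_aut B (\<omega> (g, h))) \<longleftrightarrow> ?d"
    if "?S" "?\<omega>"
    using that by (intro ball_cong refl delta_eq_iff) (auto simp: B.Aut_carrier)
  moreover have "(\<forall>g\<in>carrier G. \<forall>h\<in>carrier G. \<forall>k\<in>carrier G. dS G B S \<omega> g h k = \<one>\<^bsub>B\<^esub>) \<longleftrightarrow> ?c"
    if "?S" "?\<omega>"
  proof (intro ball_cong refl dS_eq_one_iff)
    fix g h k assume "g \<in> carrier G" "h \<in> carrier G" "k \<in> carrier G"
    then have "S g \<in> alg_hom B B" "\<omega> (h, k) \<in> carrier B"
      using that by (auto simp: alg_iso_def)
    then show "S g (\<omega> (h, k)) \<in> carrier B" by (rule alg_hom_simps)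
  qed (use that in auto)
  ultimately show ?thesis unfolding Z2_def by blast
qed

end

section \<open>The twisted group algebra of a factor system\<close>

definition monom ::
    "('g, 'm) monoid_scheme \<Rightarrow> (complex, 'b, 'n) module_scheme \<Rightarrow> 'g \<Rightarrow> 'b \<Rightarrow> 'g \<Rightarrow> 'b"
  where "monom G B g b = (\<lambda>k\<in>carrier G. if k = g then b else \<zero>\<^bsub>B\<^esub>)"

text \<open>A function stands for the formal sum of its coefficients \<open>f g\<close> times
  \<open>g\<close>. In the coefficient of a product at \<open>k\<close> the degree \<open>g\<close>
  of the left factor forces \<open>inv g k\<close> for the right one, and summing over the support
  of the left factor keeps the sum finite. Extensionality makes coefficientwise equality an equality
  of elements.\<close>

definition twisted_alg ::
    "('g, 'm) monoid_scheme \<Rightarrow> (complex, 'b, 'n) module_scheme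
      \<Rightarrow> ('g \<Rightarrow> 'b \<Rightarrow> 'b) \<Rightarrow> ('g \<times> 'g \<Rightarrow> 'b) \<Rightarrow> (complex, 'g \<Rightarrow> 'b) module"
  where "twisted_alg G B S \<omega> =
    \<lparr>carrier = {f \<in> carrier G \<rightarrow>\<^sub>E carrier B. finite {g \<in> carrier G. f g \<noteq> \<zero>\<^bsub>B\<^esub>}},
     monoid.mult = (\<lambda>f f'. \<lambda>k\<in>carrier G. finsum B
       (\<lambda>g. f g \<otimes>\<^bsub>B\<^esub> S g (f' (inv\<^bsub>G\<^esub> g \<otimes>\<^bsub>G\<^esub> k)) \<otimes>\<^bsub>B\<^esub> \<omega> (g, inv\<^bsub>G\<^esub> g \<otimes>\<^bsub>G\<^esub> k))
       {g \<in> carrier G. f g \<noteq> \<zero>\<^bsub>B\<^esub>}),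
     one = monom G B \<one>\<^bsub>G\<^esub> \<one>\<^bsub>B\<^esub>,
     zero = (\<lambda>k\<in>carrier G. \<zero>\<^bsub>B\<^esub>),
     add = (\<lambda>f f'. \<lambda>k\<in>carrier G. f k \<oplus>\<^bsub>B\<^esub> f' k),
     smult = (\<lambda>c f. \<lambda>k\<in>carrier G. c \<odot>\<^bsub>B\<^esub> f k)\<rparr>"

definition twisted_cp ::
    "('g, 'm) monoid_scheme \<Rightarrow> (complex, 'b, 'n) module_scheme
      \<Rightarrow> ('g \<Rightarrow> 'b \<Rightarrow> 'b) \<Rightarrow> ('g \<times> 'g \<Rightarrow> 'b) \<Rightarrow> ('g, 'b, 'g \<Rightarrow> 'b) graded_alg"
  where "twisted_cp G B S \<omega> =
    \<lparr>total = twisted_alg G B S \<omega>,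
     component = (\<lambda>g. monom G B g ` carrier B),
     base = monom G B \<one>\<^bsub>G\<^esub>\<rparr>"

locale factor_pair = group_alg G B
  for G :: "('g, 'm) monoid_scheme" and B :: "(complex, 'b, 'n) module_scheme" +
  fixes S :: "'g \<Rightarrow> 'b \<Rightarrow> 'b" and \<omega> :: "'g \<times> 'g \<Rightarrow> 'b"
  assumes Z2: "(S, \<omega>) \<in> Z2 G B"
begin

abbreviation "K \<equiv> twisted_alg G B S \<omega>"

lemma S_iso: "g \<in> carrier G \<Longrightarrow> S g \<in> alg_iso B B"
  using Z2 unfolding Z2_iff by auto

lemma S_hom: "g \<in> carrier G \<Longrightarrow> S g \<in> alg_hom B B"
  using S_iso by (auto simp: alg_iso_def)

lemma S_simps [simp]:
  assumes "g \<in> carrier G"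
  shows "x \<in> carrier B \<Longrightarrow> S g x \<in> carrier B"
    and "\<lbrakk>x \<in> carrier B; y \<in> carrier B\<rbrakk> \<Longrightarrow> S g (x \<otimes>\<^bsub>B\<^esub> y) = S g x \<otimes>\<^bsub>B\<^esub> S g y"
    and "\<lbrakk>x \<in> carrier B; y \<in> carrier B\<rbrakk> \<Longrightarrow> S g (x \<oplus>\<^bsub>B\<^esub> y) = S g x \<oplus>\<^bsub>B\<^esub> S g y"
    and "S g \<one>\<^bsub>B\<^esub> = \<one>\<^bsub>B\<^esub>"
    and "x \<in> carrier B \<Longrightarrow> S g (c \<odot>\<^bsub>B\<^esub> x) = c \<odot>\<^bsub>B\<^esub> S g x"
    and "S g \<zero>\<^bsub>B\<^esub> = \<zero>\<^bsub>B\<^esub>"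
  using alg_hom_simps[OF S_hom[OF assms]]
    alg_hom_zero[OF S_hom[OF assms] B.complex_algebra_axioms B.complex_algebra_axioms] by auto

lemma S_one [simp]: "b \<in> carrier B \<Longrightarrow> S \<one>\<^bsub>G\<^esub> b = b"
  using Z2 unfolding Z2_iff by auto

lemma \<omega>_unit [simp]: "\<lbrakk>g \<in> carrier G; h \<in> carrier G\<rbrakk> \<Longrightarrow> \<omega> (g, h) \<in> Units B"
  using Z2 unfolding Z2_iff by auto

lemma \<omega>_closed [simp]: "\<lbrakk>g \<in> carrier G; h \<in> carrier G\<rbrakk> \<Longrightarrow> \<omega> (g, h) \<in> carrier B"
  by simp

lemma \<omega>_one [simp]:
  assumes "g \<in> carrier G"
  shows "\<omega> (g, \<one>\<^bsub>G\<^esub>) = \<one>\<^bsub>B\<^esub>" "\<omega> (\<one>\<^bsub>G\<^esub>, g) = \<one>\<^bsub>B\<^esub>"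
  using Z2 assms unfolding Z2_iff by auto

lemma twist:
  "\<lbrakk>g \<in> carrier G; h \<in> carrier G; b \<in> carrier B\<rbrakk> \<Longrightarrow>
    S g (S h b) \<otimes>\<^bsub>B\<^esub> \<omega> (g, h) = \<omega> (g, h) \<otimes>\<^bsub>B\<^esub> S (g \<otimes>\<^bsub>G\<^esub> h) b"
  using Z2 unfolding Z2_iff by blast

lemma cocycle:
  "\<lbrakk>g \<in> carrier G; h \<in> carrier G; k \<in> carrier G\<rbrakk> \<Longrightarrow>
    S g (\<omega> (h, k)) \<otimes>\<^bsub>B\<^esub> \<omega> (g, h \<otimes>\<^bsub>G\<^esub> k) = \<omega> (g, h) \<otimes>\<^bsub>B\<^esub> \<omega> (g \<otimes>\<^bsub>G\<^esub> h, k)"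
  using Z2 unfolding Z2_iff by blast

section \<open>The twisted algebra as a module\<close>

lemma K_carrier:
  "f \<in> carrier K \<longleftrightarrow> f \<in> carrier G \<rightarrow>\<^sub>E carrier B \<and> finite {g \<in> carrier G. f g \<noteq> \<zero>\<^bsub>B\<^esub>}"
  by (simp add: twisted_alg_def)

lemma K_coeff [simp]: "\<lbrakk>f \<in> carrier K; k \<in> carrier G\<rbrakk> \<Longrightarrow> f k \<in> carrier B"
  by (auto simp: K_carrier)

lemma K_supp: "f \<in> carrier K \<Longrightarrow> finite {g \<in> carrier G. f g \<noteq> \<zero>\<^bsub>B\<^esub>}"
  by (simp add: K_carrier)

lemma K_eqI:
  assumes "f \<in> carrier K" "f' \<in> carrier K" "\<And>k. k \<in> carrier G \<Longrightarrow> f k = f' k"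
  shows "f = f'"
  using assms by (auto simp: K_carrier intro: PiE_ext)

lemma K_apply:
  assumes "k \<in> carrier G"
  shows "(f \<oplus>\<^bsub>K\<^esub> f') k = f k \<oplus>\<^bsub>B\<^esub> f' k"
    and "(c \<odot>\<^bsub>K\<^esub> f) k = c \<odot>\<^bsub>B\<^esub> f k"
    and "\<zero>\<^bsub>K\<^esub> k = \<zero>\<^bsub>B\<^esub>"
    and "monom G B g b k = (if k = g then b else \<zero>\<^bsub>B\<^esub>)"
  using assms by (simp_all add: twisted_alg_def monom_def)

lemma K_one: "\<one>\<^bsub>K\<^esub> = monom G B \<one>\<^bsub>G\<^esub> \<one>\<^bsub>B\<^esub>"
  by (simp add: twisted_alg_def)

lemma K_closed [simp]:
  shows "\<lbrakk>f \<in> carrier K; f' \<in> carrier K\<rbrakk> \<Longrightarrow> f \<oplus>\<^bsub>K\<^esub> f' \<in> carrier K"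
    and "f \<in> carrier K \<Longrightarrow> c \<odot>\<^bsub>K\<^esub> f \<in> carrier K"
    and "\<zero>\<^bsub>K\<^esub> \<in> carrier K"
    and "b \<in> carrier B \<Longrightarrow> monom G B g b \<in> carrier K"
proof -
  show "\<zero>\<^bsub>K\<^esub> \<in> carrier K"
    by (simp add: twisted_alg_def)
  show "monom G B g b \<in> carrier K" if "b \<in> carrier B"
  proof -
    have "finite {k \<in> carrier G. monom G B g b k \<noteq> \<zero>\<^bsub>B\<^esub>}"
      by (rule finite_subset[of _ "{g}"]) (auto simp: monom_def split: if_splits)
    then show ?thesis using that by (auto simp: K_carrier monom_def)
  qed
  show "c \<odot>\<^bsub>K\<^esub> f \<in> carrier K" if f: "f \<in> carrier K"
  proof -
    have "finite {k \<in> carrier G. (c \<odot>\<^bsub>K\<^esub> f) k \<noteq> \<zero>\<^bsub>B\<^esub>}"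
      by (rule finite_subset[OF _ K_supp[OF f]]) (auto simp: K_apply)
    then show ?thesis using f by (auto simp: K_carrier K_apply) (auto simp: twisted_alg_def)
  qed
  show "f \<oplus>\<^bsub>K\<^esub> f' \<in> carrier K" if f: "f \<in> carrier K" "f' \<in> carrier K"
  proof -
    have "finite {k \<in> carrier G. (f \<oplus>\<^bsub>K\<^esub> f') k \<noteq> \<zero>\<^bsub>B\<^esub>}"
      by (rule finite_subset[OF _ finite_UnI[OF K_supp[OF f(1)] K_supp[OF f(2)]]])
        (auto simp: K_apply)
    then show ?thesis using f by (auto simp: K_carrier K_apply) (auto simp: twisted_alg_def)
  qed
qed

lemma K_abelian_group: "abelian_group K"
proof (rule abelian_groupI)
  fix f assume f: "f \<in> carrier K"
  \<comment> \<open>Negatives are taken to be multiples by the scalar \<open>-1\<close>, so their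
    finite support is already known.\<close>
  have "(- 1) \<odot>\<^bsub>B\<^esub> f k \<oplus>\<^bsub>B\<^esub> f k = \<zero>\<^bsub>B\<^esub>" if "k \<in> carrier G" for k
    using B.smult_l_distr[of "-1" 1 "f k"] B.smult_one[of "f k"] B.smult_l_null[of "f k"] f that
    by simp
  then show "\<exists>f'\<in>carrier K. f' \<oplus>\<^bsub>K\<^esub> f = \<zero>\<^bsub>K\<^esub>"
    using f by (intro bexI[of _ "(-1) \<odot>\<^bsub>K\<^esub> f"] K_eqI) (simp_all add: K_apply)
qed (auto intro!: K_eqI simp: K_apply B.a_ac)

lemma K_module: "module complex_ring K"
proof (rule moduleI[OF module.axioms(1)[OF B.module_axioms] K_abelian_group])
  fix a b :: complex and f f' assume f: "f \<in> carrier K"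
  show "a \<odot>\<^bsub>K\<^esub> f \<in> carrier K" using f by simp
  show "(a \<oplus>\<^bsub>complex_ring\<^esub> b) \<odot>\<^bsub>K\<^esub> f = a \<odot>\<^bsub>K\<^esub> f \<oplus>\<^bsub>K\<^esub> b \<odot>\<^bsub>K\<^esub> f"
    using f B.smult_l_distr by (auto intro!: K_eqI simp: K_apply)
  show "(a \<otimes>\<^bsub>complex_ring\<^esub> b) \<odot>\<^bsub>K\<^esub> f = a \<odot>\<^bsub>K\<^esub> (b \<odot>\<^bsub>K\<^esub> f)"
    using f B.smult_assoc1 by (auto intro!: K_eqI simp: K_apply)
  show "\<one>\<^bsub>complex_ring\<^esub> \<odot>\<^bsub>K\<^esub> f = f"
    using f B.smult_one by (auto intro!: K_eqI simp: K_apply)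
  assume "f' \<in> carrier K"
  then show "a \<odot>\<^bsub>K\<^esub> (f \<oplus>\<^bsub>K\<^esub> f') = a \<odot>\<^bsub>K\<^esub> f \<oplus>\<^bsub>K\<^esub> a \<odot>\<^bsub>K\<^esub> f'"
    using f B.smult_r_distr by (auto intro!: K_eqI simp: K_apply)
qed

text \<open>The monomials generate \<open>K\<close> additively. Once the distributive laws are
  available, every additive identity reduces to monomials, and sums over supports disappear from the
  later computations.\<close>

lemma K_induct [consumes 1, case_names monom add]:
  assumes "f \<in> carrier K"
    and monom: "\<And>g b. \<lbrakk>g \<in> carrier G; b \<in> carrier B\<rbrakk> \<Longrightarrow> P (monom G B g b)"
    and add: "\<And>f f'. \<lbrakk>f \<in> carrier K; f' \<in> carrier K; P f; P f'\<rbrakk> \<Longrightarrow> P (f \<oplus>\<^bsub>K\<^esub> f')"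
  shows "P f"
proof -
  \<comment> \<open>The induction runs over a finite set containing the support, not over the
    support itself: erasing one coefficient then always leaves a function for the smaller set,
    whether or not that coefficient was nonzero.\<close>
  have "P f" if "finite F" "f \<in> carrier K" "{g \<in> carrier G. f g \<noteq> \<zero>\<^bsub>B\<^esub>} \<subseteq> F" for F f
    using that
  proof (induction F arbitrary: f)
    case empty
    \<comment> \<open>The zero function is itself a monomial, with coefficient zero; hence the
      induction rule has no separate case for it.\<close>
    then have "f = monom G B \<one>\<^bsub>G\<^esub> \<zero>\<^bsub>B\<^esub>"
      by (intro K_eqI) (auto simp: K_apply)
    then show ?case using monom by simp
  next
    case (insert i F)
    show ?case
    proof (cases "i \<in> carrier G")
      case True
      let ?f = "f(i := \<zero>\<^bsub>B\<^esub>)"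
      have supp: "{g \<in> carrier G. ?f g \<noteq> \<zero>\<^bsub>B\<^esub>} \<subseteq> F"
        using insert.prems(2) by auto
      then have "finite {g \<in> carrier G. ?f g \<noteq> \<zero>\<^bsub>B\<^esub>}"
        using insert.hyps(1) finite_subset by blast
      then have f: "?f \<in> carrier K"
        using insert.prems(1) True by (auto simp: K_carrier PiE_iff extensional_def)
      have fi: "f i \<in> carrier B"
        using insert.prems(1) True by simp
      have "f = monom G B i (f i) \<oplus>\<^bsub>K\<^esub> ?f"
        using f fi insert.prems(1) by (intro K_eqI) (auto simp: K_apply)
      then show ?thesis
        using add[OF K_closed(4)[OF fi] f monom[OF True fi] insert.IH[OF f supp]] by metis
    next
      case False
      then show ?thesis using insert by (intro insert.IH) auto
    qed
  qed
  from this[OF K_supp] assms(1) show ?thesis by blast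
qed

section \<open>The twisted product\<close>

text \<open>Terms with \<open>f g\<close> zero vanish, so the index set may be enlarged. This is
  what allows products with different left factors to be compared over a common finite set.\<close>

lemma K_mult_apply:
  assumes f: "f \<in> carrier K" "f' \<in> carrier K" and k: "k \<in> carrier G"
    and F: "finite F" "F \<subseteq> carrier G" "{g \<in> carrier G. f g \<noteq> \<zero>\<^bsub>B\<^esub>} \<subseteq> F"
  shows "(f \<otimes>\<^bsub>K\<^esub> f') k = finsum B
    (\<lambda>g. f g \<otimes>\<^bsub>B\<^esub> S g (f' (inv\<^bsub>G\<^esub> g \<otimes>\<^bsub>G\<^esub> k)) \<otimes>\<^bsub>B\<^esub> \<omega> (g, inv\<^bsub>G\<^esub> g \<otimes>\<^bsub>G\<^esub> k)) F"
proof -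
  have "(f \<otimes>\<^bsub>K\<^esub> f') k = finsum B
    (\<lambda>g. f g \<otimes>\<^bsub>B\<^esub> S g (f' (inv\<^bsub>G\<^esub> g \<otimes>\<^bsub>G\<^esub> k)) \<otimes>\<^bsub>B\<^esub> \<omega> (g, inv\<^bsub>G\<^esub> g \<otimes>\<^bsub>G\<^esub> k))
    {g \<in> carrier G. f g \<noteq> \<zero>\<^bsub>B\<^esub>}"
    using k by (simp add: twisted_alg_def)
  also have "\<dots> = finsum B
    (\<lambda>g. f g \<otimes>\<^bsub>B\<^esub> S g (f' (inv\<^bsub>G\<^esub> g \<otimes>\<^bsub>G\<^esub> k)) \<otimes>\<^bsub>B\<^esub> \<omega> (g, inv\<^bsub>G\<^esub> g \<otimes>\<^bsub>G\<^esub> k)) F"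
    by (rule B.add.finprod_mono_neutral_cong_left)
       (use F f k in \<open>auto simp: subset_iff\<close>)
  finally show ?thesis .
qed

lemma K_mult_closed [simp]:
  assumes f: "f \<in> carrier K" "f' \<in> carrier K"
  shows "f \<otimes>\<^bsub>K\<^esub> f' \<in> carrier K"
proof -
  let ?s = "{g \<in> carrier G. f g \<noteq> \<zero>\<^bsub>B\<^esub>}" and ?s' = "{g \<in> carrier G. f' g \<noteq> \<zero>\<^bsub>B\<^esub>}"
  have val: "(f \<otimes>\<^bsub>K\<^esub> f') k = finsum B
    (\<lambda>g. f g \<otimes>\<^bsub>B\<^esub> S g (f' (inv\<^bsub>G\<^esub> g \<otimes>\<^bsub>G\<^esub> k)) \<otimes>\<^bsub>B\<^esub> \<omega> (g, inv\<^bsub>G\<^esub> g \<otimes>\<^bsub>G\<^esub> k)) ?s"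
    if "k \<in> carrier G" for k
    using K_mult_apply[OF f that K_supp[OF f(1)]] by simp
  have cl: "(f \<otimes>\<^bsub>K\<^esub> f') k \<in> carrier B" if "k \<in> carrier G" for k
    unfolding val[OF that] by (rule B.finsum_closed) (use f that in auto)
  have "{k \<in> carrier G. (f \<otimes>\<^bsub>K\<^esub> f') k \<noteq> \<zero>\<^bsub>B\<^esub>} \<subseteq> (\<lambda>(g, h). g \<otimes>\<^bsub>G\<^esub> h) ` (?s \<times> ?s')"
  proof (rule ccontr)
    assume "\<not> ?thesis"
    then obtain k where k: "k \<in> carrier G" "(f \<otimes>\<^bsub>K\<^esub> f') k \<noteq> \<zero>\<^bsub>B\<^esub>"
        "k \<notin> (\<lambda>(g, h). g \<otimes>\<^bsub>G\<^esub> h) ` (?s \<times> ?s')"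
      by blast
    \<comment> \<open>If this coefficient were nonzero, then \<open>k = g (inv g k)\<close> would be
      a product of two support elements. Hence every term of the coefficient at \<open>k\<close> has
      a zero factor.\<close>
    have "f' (inv\<^bsub>G\<^esub> g \<otimes>\<^bsub>G\<^esub> k) = \<zero>\<^bsub>B\<^esub>" if g: "g \<in> ?s" for g
    proof (rule ccontr)
      assume "f' (inv\<^bsub>G\<^esub> g \<otimes>\<^bsub>G\<^esub> k) \<noteq> \<zero>\<^bsub>B\<^esub>"
      then have "(g, inv\<^bsub>G\<^esub> g \<otimes>\<^bsub>G\<^esub> k) \<in> ?s \<times> ?s'" "k = g \<otimes>\<^bsub>G\<^esub> (inv\<^bsub>G\<^esub> g \<otimes>\<^bsub>G\<^esub> k)"
        using g k(1) by (auto simp flip: G.m_assoc)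
      with k(3) show False by (metis (no_types, lifting) case_prod_conv image_eqI)
    qed
    then have "(f \<otimes>\<^bsub>K\<^esub> f') k = \<zero>\<^bsub>B\<^esub>"
      unfolding val[OF k(1)] using f k(1) by (intro B.add.finprod_one_eqI) auto
    with k(2) show False by contradiction
  qed
  then have "finite {k \<in> carrier G. (f \<otimes>\<^bsub>K\<^esub> f') k \<noteq> \<zero>\<^bsub>B\<^esub>}"
    using K_supp[OF f(1)] K_supp[OF f(2)] by (meson finite_SigmaI finite_imageI finite_subset)
  moreover have "f \<otimes>\<^bsub>K\<^esub> f' \<in> extensional (carrier G)"
    by (simp add: twisted_alg_def)
  ultimately show ?thesis
    using cl by (auto simp: K_carrier PiE_iff)
qed

lemma K_l_distr:
  assumes f: "x \<in> carrier K" "y \<in> carrier K" "z \<in> carrier K"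
  shows "(x \<oplus>\<^bsub>K\<^esub> y) \<otimes>\<^bsub>K\<^esub> z = x \<otimes>\<^bsub>K\<^esub> z \<oplus>\<^bsub>K\<^esub> y \<otimes>\<^bsub>K\<^esub> z"
proof (rule K_eqI)
  fix k assume k: "k \<in> carrier G"
  \<comment> \<open>Addition can shrink supports by cancellation; the union of the two supports is
    an index set for all three products.\<close>
  let ?F = "{g \<in> carrier G. x g \<noteq> \<zero>\<^bsub>B\<^esub>} \<union> {g \<in> carrier G. y g \<noteq> \<zero>\<^bsub>B\<^esub>}"
  have F: "finite ?F" "?F \<subseteq> carrier G"
    using f K_supp by auto
  have sub: "{g \<in> carrier G. (x \<oplus>\<^bsub>K\<^esub> y) g \<noteq> \<zero>\<^bsub>B\<^esub>} \<subseteq> ?F"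
    using f by (auto simp: K_apply)
  have "((x \<oplus>\<^bsub>K\<^esub> y) \<otimes>\<^bsub>K\<^esub> z) k = finsum B (\<lambda>g.
      x g \<otimes>\<^bsub>B\<^esub> S g (z (inv\<^bsub>G\<^esub> g \<otimes>\<^bsub>G\<^esub> k)) \<otimes>\<^bsub>B\<^esub> \<omega> (g, inv\<^bsub>G\<^esub> g \<otimes>\<^bsub>G\<^esub> k) \<oplus>\<^bsub>B\<^esub>
      y g \<otimes>\<^bsub>B\<^esub> S g (z (inv\<^bsub>G\<^esub> g \<otimes>\<^bsub>G\<^esub> k)) \<otimes>\<^bsub>B\<^esub> \<omega> (g, inv\<^bsub>G\<^esub> g \<otimes>\<^bsub>G\<^esub> k)) ?F"
    unfolding K_mult_apply[OF K_closed(1)[OF f(1,2)] f(3) k F sub]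
    by (rule B.finsum_cong') (use f k in \<open>auto simp: K_apply B.l_distr\<close>)
  also have "\<dots> = (x \<otimes>\<^bsub>K\<^esub> z) k \<oplus>\<^bsub>B\<^esub> (y \<otimes>\<^bsub>K\<^esub> z) k"
    unfolding K_mult_apply[OF f(1,3) k F Un_upper1] K_mult_apply[OF f(2,3) k F Un_upper2]
    by (rule B.finsum_addf) (use f k in auto)
  finally show "((x \<oplus>\<^bsub>K\<^esub> y) \<otimes>\<^bsub>K\<^esub> z) k = (x \<otimes>\<^bsub>K\<^esub> z \<oplus>\<^bsub>K\<^esub> y \<otimes>\<^bsub>K\<^esub> z) k"
    using k by (simp add: K_apply)
qed (use f in auto)

lemma K_r_distr:
  assumes f: "x \<in> carrier K" "y \<in> carrier K" "z \<in> carrier K"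
  shows "z \<otimes>\<^bsub>K\<^esub> (x \<oplus>\<^bsub>K\<^esub> y) = z \<otimes>\<^bsub>K\<^esub> x \<oplus>\<^bsub>K\<^esub> z \<otimes>\<^bsub>K\<^esub> y"
proof (rule K_eqI)
  fix k assume k: "k \<in> carrier G"
  let ?F = "{g \<in> carrier G. z g \<noteq> \<zero>\<^bsub>B\<^esub>}"
  have F: "finite ?F" "?F \<subseteq> carrier G"
    using f K_supp by auto
  have "(z \<otimes>\<^bsub>K\<^esub> (x \<oplus>\<^bsub>K\<^esub> y)) k = finsum B (\<lambda>g.
      z g \<otimes>\<^bsub>B\<^esub> S g (x (inv\<^bsub>G\<^esub> g \<otimes>\<^bsub>G\<^esub> k)) \<otimes>\<^bsub>B\<^esub> \<omega> (g, inv\<^bsub>G\<^esub> g \<otimes>\<^bsub>G\<^esub> k) \<oplus>\<^bsub>B\<^esub>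
      z g \<otimes>\<^bsub>B\<^esub> S g (y (inv\<^bsub>G\<^esub> g \<otimes>\<^bsub>G\<^esub> k)) \<otimes>\<^bsub>B\<^esub> \<omega> (g, inv\<^bsub>G\<^esub> g \<otimes>\<^bsub>G\<^esub> k)) ?F"
    unfolding K_mult_apply[OF f(3) K_closed(1)[OF f(1,2)] k F subset_refl]
    by (rule B.finsum_cong') (use f k in \<open>auto simp: K_apply B.l_distr B.r_distr\<close>)
  also have "\<dots> = (z \<otimes>\<^bsub>K\<^esub> x) k \<oplus>\<^bsub>B\<^esub> (z \<otimes>\<^bsub>K\<^esub> y) k"
    unfolding K_mult_apply[OF f(3,1) k F subset_refl] K_mult_apply[OF f(3,2) k F subset_refl]
    by (rule B.finsum_addf) (use f k in auto)
  finally show "(z \<otimes>\<^bsub>K\<^esub> (x \<oplus>\<^bsub>K\<^esub> y)) k = (z \<otimes>\<^bsub>K\<^esub> x \<oplus>\<^bsub>K\<^esub> z \<otimes>\<^bsub>K\<^esub> y) k"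
    using k by (simp add: K_apply)
qed (use f in auto)

lemma K_monom_mult:
  assumes g: "g \<in> carrier G" "h \<in> carrier G" and b: "b \<in> carrier B" "c \<in> carrier B"
  shows "monom G B g b \<otimes>\<^bsub>K\<^esub> monom G B h c =
    monom G B (g \<otimes>\<^bsub>G\<^esub> h) (b \<otimes>\<^bsub>B\<^esub> S g c \<otimes>\<^bsub>B\<^esub> \<omega> (g, h))"
proof (rule K_eqI)
  fix k assume k: "k \<in> carrier G"
  have "inv\<^bsub>G\<^esub> g \<otimes>\<^bsub>G\<^esub> k = h \<longleftrightarrow> k = g \<otimes>\<^bsub>G\<^esub> h"
    using g k by (metis G.inv_solve_left)
  moreover have "(monom G B g b \<otimes>\<^bsub>K\<^esub> monom G B h c) k =
      b \<otimes>\<^bsub>B\<^esub> S g (monom G B h c (inv\<^bsub>G\<^esub> g \<otimes>\<^bsub>G\<^esub> k)) \<otimes>\<^bsub>B\<^esub> \<omega> (g, inv\<^bsub>G\<^esub> g \<otimes>\<^bsub>G\<^esub> k)"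
    using g b k by (subst K_mult_apply[where F = "{g}"]) (auto simp: K_apply split: if_splits)
  ultimately show "(monom G B g b \<otimes>\<^bsub>K\<^esub> monom G B h c) k =
      monom G B (g \<otimes>\<^bsub>G\<^esub> h) (b \<otimes>\<^bsub>B\<^esub> S g c \<otimes>\<^bsub>B\<^esub> \<omega> (g, h)) k"
    using g b k by (auto simp: K_apply)
qed (use g b in auto)

text \<open>Both sides are additive in each argument, so three nested inductions leave only
  monomials. There the two conditions on a factor system enter once each: \<open>twist\<close> moves
  \<open>\<omega> (g, h)\<close> to the right past the image of \<open>d\<close>, where it meets
  \<open>\<omega> (g h, k)\<close>, and \<open>cocycle\<close> rewrites this pair.\<close>

lemma K_assoc:
  assumes "x \<in> carrier K" "y \<in> carrier K" "z \<in> carrier K"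
  shows "(x \<otimes>\<^bsub>K\<^esub> y) \<otimes>\<^bsub>K\<^esub> z = x \<otimes>\<^bsub>K\<^esub> (y \<otimes>\<^bsub>K\<^esub> z)"
  using assms(1)
proof (induction rule: K_induct)
  case (monom g b)
  note gb = monom
  from assms(2) show ?case
  proof (induction rule: K_induct)
    case (monom h c)
    note hc = monom
    from assms(3) show ?case
    proof (induction rule: K_induct)
      case (monom k d)
      note kd = monom
      let ?w = "\<omega> (g, h)"
      have "b \<otimes>\<^bsub>B\<^esub> S g c \<otimes>\<^bsub>B\<^esub> ?w \<otimes>\<^bsub>B\<^esub> S (g \<otimes>\<^bsub>G\<^esub> h) d \<otimes>\<^bsub>B\<^esub> \<omega> (g \<otimes>\<^bsub>G\<^esub> h, k)
          = b \<otimes>\<^bsub>B\<^esub> S g c \<otimes>\<^bsub>B\<^esub> (?w \<otimes>\<^bsub>B\<^esub> S (g \<otimes>\<^bsub>G\<^esub> h) d) \<otimes>\<^bsub>B\<^esub> \<omega> (g \<otimes>\<^bsub>G\<^esub> h, k)"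
        using gb hc kd by (simp add: B.m_assoc)
      also have "\<dots> = b \<otimes>\<^bsub>B\<^esub> S g c \<otimes>\<^bsub>B\<^esub> S g (S h d) \<otimes>\<^bsub>B\<^esub> (?w \<otimes>\<^bsub>B\<^esub> \<omega> (g \<otimes>\<^bsub>G\<^esub> h, k))"
        using gb hc kd by (simp add: B.m_assoc flip: twist)
      also have "\<dots> = b \<otimes>\<^bsub>B\<^esub> S g (c \<otimes>\<^bsub>B\<^esub> S h d \<otimes>\<^bsub>B\<^esub> \<omega> (h, k)) \<otimes>\<^bsub>B\<^esub> \<omega> (g, h \<otimes>\<^bsub>G\<^esub> k)"
        using gb hc kd by (simp add: B.m_assoc flip: cocycle)
      finally show ?case
        using gb hc kd by (simp add: K_monom_mult G.m_assoc)
    qed (use gb hc in \<open>simp add: K_r_distr\<close>)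
  qed (use gb assms(3) in \<open>simp add: K_l_distr K_r_distr\<close>)
qed (use assms in \<open>simp add: K_l_distr\<close>)

lemma K_monoid: "monoid K"
proof (rule monoidI)
  fix x assume "x \<in> carrier K"
  then show "\<one>\<^bsub>K\<^esub> \<otimes>\<^bsub>K\<^esub> x = x"
    by (induction rule: K_induct) (simp_all add: K_one K_monom_mult K_r_distr)
next
  fix x assume "x \<in> carrier K"
  then show "x \<otimes>\<^bsub>K\<^esub> \<one>\<^bsub>K\<^esub> = x"
    by (induction rule: K_induct) (simp_all add: K_one K_monom_mult K_l_distr)
qed (simp_all add: K_one K_assoc)

lemma K_smult_monom: "b \<in> carrier B \<Longrightarrow> c \<odot>\<^bsub>K\<^esub> monom G B g b = monom G B g (c \<odot>\<^bsub>B\<^esub> b)"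
  by (rule K_eqI) (auto simp: K_apply)

lemma K_algebra: "complex_algebra K"
proof -
  interpret M: module complex_ring K by (rule K_module)
  interpret R: ring K
    by (rule ringI[OF K_abelian_group K_monoid K_l_distr K_r_distr])
  have sr: "c \<odot>\<^bsub>K\<^esub> (x \<oplus>\<^bsub>K\<^esub> y) = c \<odot>\<^bsub>K\<^esub> x \<oplus>\<^bsub>K\<^esub> c \<odot>\<^bsub>K\<^esub> y" if "x \<in> carrier K" "y \<in> carrier K" for c x y
    using M.smult_r_distr that by simp
  show ?thesis
  proof unfold_locales
    fix c x y assume x: "x \<in> carrier K" and y: "y \<in> carrier K"
    show "c \<odot>\<^bsub>K\<^esub> x \<otimes>\<^bsub>K\<^esub> y = c \<odot>\<^bsub>K\<^esub> (x \<otimes>\<^bsub>K\<^esub> y)" using x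
    proof (induction rule: K_induct)
      case (monom g b)
      note gb = monom
      from y show ?case
      proof (induction rule: K_induct)
        case (monom h d)
        then show ?case using gb by (simp add: K_smult_monom K_monom_mult B.smult_mult_left)
      qed (use gb in \<open>simp add: K_r_distr sr\<close>)
    qed (use y in \<open>simp add: K_l_distr sr\<close>)
    show "x \<otimes>\<^bsub>K\<^esub> (c \<odot>\<^bsub>K\<^esub> y) = c \<odot>\<^bsub>K\<^esub> (x \<otimes>\<^bsub>K\<^esub> y)" using x
    proof (induction rule: K_induct)
      case (monom g b)
      note gb = monom
      from y show ?case
      proof (induction rule: K_induct)
        case (monom h d)
        then show ?case using gb
          by (simp add: K_smult_monom K_monom_mult B.smult_mult_left B.smult_mult_right)
      qed (use gb in \<open>simp add: K_r_distr sr\<close>)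
    qed (use y in \<open>simp add: K_l_distr sr\<close>)
  qed
qed

sublocale K: complex_algebra K
  by (rule K_algebra)

section \<open>Grading and homogeneous units of the twisted algebra\<close>

abbreviation "KX \<equiv> twisted_cp G B S \<omega>"

lemma KX_simps [simp]:
  "total KX = K" "component KX = (\<lambda>g. monom G B g ` carrier B)" "base KX = monom G B \<one>\<^bsub>G\<^esub>"
  by (simp_all add: twisted_cp_def)

lemma K_finsum_apply:
  assumes "x \<in> F \<rightarrow> carrier K" "k \<in> carrier G"
  shows "finsum K x F k = finsum B (\<lambda>i. x i k) F"
  using assms(1)
proof (induction F rule: infinite_finite_induct)
  case (insert i F)
  then have x: "x \<in> F \<rightarrow> carrier K" "x i \<in> carrier K" by auto
  then have "(\<lambda>i. x i k) \<in> F \<rightarrow> carrier B" "x i k \<in> carrier B"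
    using assms(2) by (auto simp: Pi_iff)
  then show ?case using insert x assms(2)
    by (simp add: K.finsum_insert B.finsum_insert K_apply)
qed (use assms(2) in \<open>simp_all add: K_apply\<close>)

lemma monom_add:
  "\<lbrakk>b \<in> carrier B; c \<in> carrier B\<rbrakk> \<Longrightarrow> monom G B g (b \<oplus>\<^bsub>B\<^esub> c) = monom G B g b \<oplus>\<^bsub>K\<^esub> monom G B g c"
  by (rule K_eqI) (auto simp: K_apply)

lemma monom_zero: "monom G B g \<zero>\<^bsub>B\<^esub> = \<zero>\<^bsub>K\<^esub>"
  by (rule K_eqI) (auto simp: K_apply)

lemma monom_eq_iff: "g \<in> carrier G \<Longrightarrow> monom G B g b = monom G B g c \<longleftrightarrow> b = c"
  by (metis K_apply(4))

lemma K_component_submodule: "submodule (monom G B g ` carrier B) complex_ring K"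
proof (rule K.submoduleI)
  show "\<zero>\<^bsub>K\<^esub> \<in> monom G B g ` carrier B"
    by (metis B.zero_closed image_eqI monom_zero)
next
  fix a assume "a \<in> monom G B g ` carrier B"
  then obtain b where b: "b \<in> carrier B" "a = monom G B g b" by auto
  have "monom G B g (\<ominus>\<^bsub>B\<^esub> b) \<oplus>\<^bsub>K\<^esub> a = \<zero>\<^bsub>K\<^esub>"
    using b by (simp add: monom_zero B.l_neg flip: monom_add)
  then have "\<ominus>\<^bsub>K\<^esub> a = monom G B g (\<ominus>\<^bsub>B\<^esub> b)"
    using b by (simp add: K.minus_equality)
  then show "\<ominus>\<^bsub>K\<^esub> a \<in> monom G B g ` carrier B"
    using b by simp
next
  fix a b assume "a \<in> monom G B g ` carrier B" "b \<in> monom G B g ` carrier B"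
  then show "a \<oplus>\<^bsub>K\<^esub> b \<in> monom G B g ` carrier B"
    by (auto simp flip: monom_add)
next
  fix c a assume "a \<in> monom G B g ` carrier B"
  then show "c \<odot>\<^bsub>K\<^esub> a \<in> monom G B g ` carrier B"
    using B.smult_closed by (auto simp: K_smult_monom)
qed auto

text \<open>Evaluation at \<open>k\<close> annihilates every summand of degree different from
  \<open>k\<close>. Thus the sum determines the coefficient of each summand, which gives existence
  and uniqueness of the decomposition at once.\<close>

lemma K_finsum_components:
  assumes f: "f \<in> (\<Pi>\<^sub>E i\<in>carrier G. monom G B i ` carrier B)"
    and fin: "finite {i \<in> carrier G. f i \<noteq> \<zero>\<^bsub>K\<^esub>}" and k: "k \<in> carrier G"
  shows "finsum K f {i \<in> carrier G. f i \<noteq> \<zero>\<^bsub>K\<^esub>} k = f k k"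
proof -
  let ?F = "{i \<in> carrier G. f i \<noteq> \<zero>\<^bsub>K\<^esub>}"
  have fK: "f i \<in> carrier K" if "i \<in> carrier G" for i
    using PiE_mem[OF f that] by auto
  have off: "f i k = \<zero>\<^bsub>B\<^esub>" if i: "i \<in> carrier G" "i \<noteq> k" for i
  proof -
    obtain b where "f i = monom G B i b" using PiE_mem[OF f i(1)] by auto
    then show ?thesis using i k by (simp add: K_apply)
  qed
  have "finsum K f ?F k = finsum B (\<lambda>i. f i k) ?F"
    using fK k by (intro K_finsum_apply) auto
  \<comment> \<open>The degree \<open>k\<close> is adjoined because it is missing from the index set
    when \<open>f k\<close> is zero.\<close>
  also have "\<dots> = finsum B (\<lambda>i. f i k) (insert k ?F)"
    by (rule B.add.finprod_mono_neutral_cong_left) (use fin fK k in \<open>auto simp: K_apply\<close>)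
  also have "\<dots> = finsum B (\<lambda>i. if k = i then f i k else \<zero>\<^bsub>B\<^esub>) (insert k ?F)"
    by (rule B.finsum_cong') (use off fK k in auto)
  also have "\<dots> = f k k"
    by (rule B.finsum_singleton) (use fin fK k in auto)
  finally show ?thesis .
qed

lemma K_direct_sum: "direct_sum_decomp K (carrier G) (\<lambda>g. monom G B g ` carrier B)"
  unfolding direct_sum_decomp_def
proof (intro conjI ballI)
  fix a assume a: "a \<in> carrier K"
  let ?P = "\<lambda>f. f \<in> (\<Pi>\<^sub>E i\<in>carrier G. monom G B i ` carrier B) \<and>
    finite {i \<in> carrier G. f i \<noteq> \<zero>\<^bsub>K\<^esub>} \<and> a = finsum K f {i \<in> carrier G. f i \<noteq> \<zero>\<^bsub>K\<^esub>}"
  let ?f = "\<lambda>i\<in>carrier G. monom G B i (a i)"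
  have f: "?f \<in> (\<Pi>\<^sub>E i\<in>carrier G. monom G B i ` carrier B)"
    using a by auto
  have "{i \<in> carrier G. ?f i \<noteq> \<zero>\<^bsub>K\<^esub>} \<subseteq> {i \<in> carrier G. a i \<noteq> \<zero>\<^bsub>B\<^esub>}"
    by (auto simp: monom_zero)
  then have fin: "finite {i \<in> carrier G. ?f i \<noteq> \<zero>\<^bsub>K\<^esub>}"
    using K_supp[OF a] finite_subset by blast
  have "finsum K ?f {i \<in> carrier G. ?f i \<noteq> \<zero>\<^bsub>K\<^esub>} \<in> carrier K"
    by (rule K.finsum_closed) (use a in auto)
  then have "a = finsum K ?f {i \<in> carrier G. ?f i \<noteq> \<zero>\<^bsub>K\<^esub>}"
    using a by (intro K_eqI) (simp_all only: K_finsum_components[OF f fin], simp add: K_apply)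
  then have "?P ?f" using f fin by blast
  moreover have "f = ?f" if P: "?P f" for f
  proof (rule extensionalityI[of _ "carrier G"])
    fix i assume i: "i \<in> carrier G"
    have "f i i = a i"
      using P K_finsum_components[of f i] i by metis
    moreover obtain b where "f i = monom G B i b"
      using PiE_mem[OF conjunct1[OF P] i] by auto
    ultimately show "f i = ?f i"
      using i by (simp add: K_apply)
  qed (use P in \<open>auto simp: PiE_iff\<close>)
  ultimately show "\<exists>!f. ?P f" by blast
qed (rule K_component_submodule)

text \<open>Multiplicativity and the unit rest on normalisation: \<open>S\<close> is the identity at
  the neutral element and \<open>\<omega>\<close> is one there, so in degree one the twisted product
  is the product of \<open>B\<close>.\<close>

lemma monom_base_hom: "monom G B \<one>\<^bsub>G\<^esub> \<in> alg_hom B K"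
  by (rule alg_homI) (simp_all add: K_monom_mult monom_add K_smult_monom K_one)

text \<open>A left inverse in degree \<open>inv g\<close> can be written down directly. For a right
  inverse the coefficient has to be a preimage under \<open>S g\<close>, which exists because
  \<open>S g\<close> is surjective. The two agree by associativity of \<open>K\<close>.\<close>

lemma monom_Units:
  assumes g: "g \<in> carrier G"
  shows "monom G B g \<one>\<^bsub>B\<^esub> \<in> Units K"
proof -
  let ?g' = "inv\<^bsub>G\<^esub> g"
  obtain b where b: "b \<in> carrier B" "S g b = inv\<^bsub>B\<^esub> (\<omega> (g, ?g'))"
    using alg_isoD(4)[OF S_iso[OF g]] g by (metis B.Units_inv_closed G.inv_closed \<omega>_unit imageE)
  have r: "monom G B g \<one>\<^bsub>B\<^esub> \<otimes>\<^bsub>K\<^esub> monom G B ?g' b = \<one>\<^bsub>K\<^esub>"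
    using g b by (simp add: K_monom_mult K_one)
  have l: "monom G B ?g' (inv\<^bsub>B\<^esub> (\<omega> (?g', g))) \<otimes>\<^bsub>K\<^esub> monom G B g \<one>\<^bsub>B\<^esub> = \<one>\<^bsub>K\<^esub>"
    using g by (simp add: K_monom_mult K_one)
  have "monom G B ?g' b = monom G B ?g' (inv\<^bsub>B\<^esub> (\<omega> (?g', g)))"
    by (rule K.inv_unique[OF l r, symmetric]) (use g b in auto)
  with l r b g show ?thesis
    unfolding Units_def by (auto intro!: bexI[of _ "monom G B ?g' b"])
qed

lemma KX_crossed_product: "KX \<in> crossed_products G B"
proof -
  have "bij_betw (monom G B \<one>\<^bsub>G\<^esub>) (carrier B) (monom G B \<one>\<^bsub>G\<^esub> ` carrier B)"
    by (auto simp: bij_betw_def inj_on_def monom_eq_iff)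
  moreover have "x \<otimes>\<^bsub>K\<^esub> y \<in> monom G B (g \<otimes>\<^bsub>G\<^esub> h) ` carrier B"
    if "g \<in> carrier G" "h \<in> carrier G" "x \<in> monom G B g ` carrier B" "y \<in> monom G B h ` carrier B"
    for g h x y
  proof -
    obtain b c where "b \<in> carrier B" "c \<in> carrier B" "x = monom G B g b" "y = monom G B h c"
      using \<open>x \<in> _\<close> \<open>y \<in> _\<close> by blast
    then show ?thesis using that(1,2) by (simp add: K_monom_mult)
  qed
  moreover have "monom G B g ` carrier B \<inter> Units K \<noteq> {}" if "g \<in> carrier G" for g
    using monom_Units[OF that] by blast
  ultimately show ?thesis
    unfolding crossed_products_def
    using K_algebra K_direct_sum monom_base_hom by simp
qed

end

section \<open>Factor systems of crossed products\<close>

locale crossed_product = group_alg G B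
  for G :: "('g, 'm) monoid_scheme" and B :: "(complex, 'b, 'n) module_scheme" +
  fixes X :: "('g, 'b, 'a) graded_alg"
  assumes X: "X \<in> crossed_products G B"
begin

abbreviation "A \<equiv> total X"
abbreviation "\<beta> \<equiv> base X"

sublocale A: complex_algebra A
  using X by (simp add: crossed_products_def)

lemma direct_sum: "direct_sum_decomp A (carrier G) (component X)"
  using X by (simp add: crossed_products_def)

lemma component_submodule: "g \<in> carrier G \<Longrightarrow> submodule (component X g) complex_ring A"
  using direct_sum by (simp add: direct_sum_decomp_def)

lemma component_closed [simp]: "\<lbrakk>x \<in> component X g; g \<in> carrier G\<rbrakk> \<Longrightarrow> x \<in> carrier A"
  using A.submoduleE(1)[OF component_submodule] by blast

lemma component_zero [simp]: "g \<in> carrier G \<Longrightarrow> \<zero>\<^bsub>A\<^esub> \<in> component X g"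
  using subgroup.one_closed[OF submodule.axioms(1)[OF component_submodule]] by simp

lemma component_mult:
  "\<lbrakk>x \<in> component X g; y \<in> component X h; g \<in> carrier G; h \<in> carrier G\<rbrakk>
    \<Longrightarrow> x \<otimes>\<^bsub>A\<^esub> y \<in> component X (g \<otimes>\<^bsub>G\<^esub> h)"
  using X by (simp add: crossed_products_def)

lemma base_hom: "\<beta> \<in> alg_hom B A"
  using X by (simp add: crossed_products_def)

lemmas base_simps [simp] = alg_hom_simps[OF base_hom]
  alg_hom_zero[OF base_hom B.complex_algebra_axioms A.complex_algebra_axioms]

lemma base_bij: "bij_betw \<beta> (carrier B) (component X \<one>\<^bsub>G\<^esub>)"
  using X by (simp add: crossed_products_def)

lemma base_eq_iff: "\<lbrakk>b \<in> carrier B; c \<in> carrier B\<rbrakk> \<Longrightarrow> \<beta> b = \<beta> c \<longleftrightarrow> b = c"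
  using base_bij by (auto simp: bij_betw_def inj_on_def)

lemma base_component [simp]: "b \<in> carrier B \<Longrightarrow> \<beta> b \<in> component X \<one>\<^bsub>G\<^esub>"
  using base_bij by (auto simp: bij_betw_def)

lemma base_surj:
  assumes "a \<in> component X \<one>\<^bsub>G\<^esub>"
  obtains b where "b \<in> carrier B" "a = \<beta> b"
  using base_bij assms by (auto simp: bij_betw_def)

lemma inv_into_base:
  assumes "a \<in> component X \<one>\<^bsub>G\<^esub>"
  shows "inv_into (carrier B) \<beta> a \<in> carrier B" "\<beta> (inv_into (carrier B) \<beta> a) = a"
  using assms base_bij by (auto simp: bij_betw_def inv_into_into f_inv_into_f)

section \<open>Homogeneous decompositions and inverses\<close>

lemma decomp_exists:
  assumes "a \<in> carrier A"
  obtains f where "f \<in> (\<Pi>\<^sub>E i\<in>carrier G. component X i)" "finite {i \<in> carrier G. f i \<noteq> \<zero>\<^bsub>A\<^esub>}"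
    "a = finsum A f {i \<in> carrier G. f i \<noteq> \<zero>\<^bsub>A\<^esub>}"
  using direct_sum assms unfolding direct_sum_decomp_def by blast

text \<open>Uniqueness in \<open>direct_sum_decomp\<close> refers to sums over the exact support,
  which may differ between the two families. Since both vanish outside \<open>F\<close>, the sums
  over \<open>F\<close> are the sums over the supports.\<close>

lemma decomp_unique:
  assumes F: "finite F" "F \<subseteq> carrier G"
    and f: "f \<in> (\<Pi>\<^sub>E i\<in>carrier G. component X i)" "f' \<in> (\<Pi>\<^sub>E i\<in>carrier G. component X i)"
    and 0: "\<And>i. i \<in> carrier G - F \<Longrightarrow> f i = \<zero>\<^bsub>A\<^esub>" "\<And>i. i \<in> carrier G - F \<Longrightarrow> f' i = \<zero>\<^bsub>A\<^esub>"
    and eq: "finsum A f F = finsum A f' F"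
  shows "f = f'"
proof -
  have supp: "finite {i \<in> carrier G. x i \<noteq> \<zero>\<^bsub>A\<^esub>}"
      "finsum A x {i \<in> carrier G. x i \<noteq> \<zero>\<^bsub>A\<^esub>} = finsum A x F" "finsum A x F \<in> carrier A"
    if x: "x \<in> (\<Pi>\<^sub>E i\<in>carrier G. component X i)" "\<And>i. i \<in> carrier G - F \<Longrightarrow> x i = \<zero>\<^bsub>A\<^esub>" for x
  proof -
    have "{i \<in> carrier G. x i \<noteq> \<zero>\<^bsub>A\<^esub>} \<subseteq> F" using x(2) by blast
    then show "finite {i \<in> carrier G. x i \<noteq> \<zero>\<^bsub>A\<^esub>}" using F finite_subset by blast
    have xA: "x \<in> F \<rightarrow> carrier A"
      using PiE_mem[OF x(1)] component_closed F by blast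
    then show "finsum A x {i \<in> carrier G. x i \<noteq> \<zero>\<^bsub>A\<^esub>} = finsum A x F"
      by (intro A.add.finprod_mono_neutral_cong_left) (use F x(2) in auto)
    show "finsum A x F \<in> carrier A" using xA by (rule A.finsum_closed)
  qed
  have "\<exists>!x. x \<in> (\<Pi>\<^sub>E i\<in>carrier G. component X i) \<and> finite {i \<in> carrier G. x i \<noteq> \<zero>\<^bsub>A\<^esub>} \<and>
      finsum A f F = finsum A x {i \<in> carrier G. x i \<noteq> \<zero>\<^bsub>A\<^esub>}"
    using direct_sum supp(3)[OF f(1) 0(1)] unfolding direct_sum_decomp_def by blast
  moreover note f supp(1)[OF f(1) 0(1)] supp(1)[OF f(2) 0(2)]
    supp(2)[OF f(1) 0(1), symmetric] eq[THEN trans, OF supp(2)[OF f(2) 0(2), symmetric]]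
  ultimately show ?thesis by blast
qed

text \<open>If \<open>u v = 1\<close> with \<open>u\<close> of degree \<open>g\<close>, then comparing the components of degree \<open>1\<close> shows that
  already the component of \<open>v\<close> of degree \<open>g\<^sup>-\<^sup>1\<close> is a right inverse of \<open>u\<close>.\<close>

lemma inv_component:
  assumes g: "g \<in> carrier G" and u: "u \<in> component X g" "u \<in> Units A"
  shows "inv\<^bsub>A\<^esub> u \<in> component X (inv\<^bsub>G\<^esub> g)"
proof -
  obtain f where f: "f \<in> (\<Pi>\<^sub>E i\<in>carrier G. component X i)"
    and fin: "finite {i \<in> carrier G. f i \<noteq> \<zero>\<^bsub>A\<^esub>}"
    and v: "inv\<^bsub>A\<^esub> u = finsum A f {i \<in> carrier G. f i \<noteq> \<zero>\<^bsub>A\<^esub>}"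
    using decomp_exists[of "inv\<^bsub>A\<^esub> u"] u(2) by auto
  let ?F = "{i \<in> carrier G. f i \<noteq> \<zero>\<^bsub>A\<^esub>}"
  have fc: "f i \<in> component X i" "f i \<in> carrier A" if "i \<in> carrier G" for i
    using PiE_mem[OF f that] that by auto
  \<comment> \<open>\<open>t\<close> lists the components of \<open>u inv u\<close> by degree: a
    term \<open>u f h\<close> has degree \<open>g h\<close>, so degree \<open>k\<close> comes from
    \<open>h = inv g k\<close>. The family \<open>d\<close> lists the components of the unit
    element.\<close>
  define t where "t = (\<lambda>k\<in>carrier G. u \<otimes>\<^bsub>A\<^esub> f (inv\<^bsub>G\<^esub> g \<otimes>\<^bsub>G\<^esub> k))"
  define d where "d = (\<lambda>k\<in>carrier G. if \<one>\<^bsub>G\<^esub> = k then \<one>\<^bsub>A\<^esub> else \<zero>\<^bsub>A\<^esub>)"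
  let ?T = "(\<lambda>h. g \<otimes>\<^bsub>G\<^esub> h) ` ?F"
  have tc: "t k \<in> component X k" if "k \<in> carrier G" for k
  proof -
    have "u \<otimes>\<^bsub>A\<^esub> f (inv\<^bsub>G\<^esub> g \<otimes>\<^bsub>G\<^esub> k) \<in> component X (g \<otimes>\<^bsub>G\<^esub> (inv\<^bsub>G\<^esub> g \<otimes>\<^bsub>G\<^esub> k))"
      using u fc g that by (intro component_mult) auto
    then show ?thesis using g that by (simp add: t_def flip: G.m_assoc)
  qed
  have t: "t \<in> (\<Pi>\<^sub>E i\<in>carrier G. component X i)"
    using tc by (auto simp: t_def)
  have one: "\<one>\<^bsub>A\<^esub> \<in> component X \<one>\<^bsub>G\<^esub>"
    using base_component[OF B.one_closed] by simp
  have d: "d \<in> (\<Pi>\<^sub>E i\<in>carrier G. component X i)"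
    using one by (auto simp: d_def)
  have t0: "t k = \<zero>\<^bsub>A\<^esub>" if k: "k \<in> carrier G" "k \<notin> ?T" for k
  proof -
    have "k = g \<otimes>\<^bsub>G\<^esub> (inv\<^bsub>G\<^esub> g \<otimes>\<^bsub>G\<^esub> k)" "inv\<^bsub>G\<^esub> g \<otimes>\<^bsub>G\<^esub> k \<in> carrier G"
      using g k by (simp_all flip: G.m_assoc)
    then have "f (inv\<^bsub>G\<^esub> g \<otimes>\<^bsub>G\<^esub> k) = \<zero>\<^bsub>A\<^esub>"
      using k(2) by blast
    then show ?thesis using k(1) u(2) by (simp add: t_def)
  qed
  have tA: "t k \<in> carrier A" if "k \<in> carrier G" for k
    using tc[OF that] that by simp
  have TG: "?T \<subseteq> carrier G" "finite ?T" using g fin by auto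
  \<comment> \<open>Degree one is adjoined because \<open>d\<close> is supported there, while it is
    not yet known to lie in \<open>?T\<close>.\<close>
  have "finsum A t (insert \<one>\<^bsub>G\<^esub> ?T) = finsum A t ?T"
    by (rule A.add.finprod_mono_neutral_cong_right) (use t0 tA TG in auto)
  also have "\<dots> = finsum A (\<lambda>h. t (g \<otimes>\<^bsub>G\<^esub> h)) ?F"
    by (rule A.finsum_reindex) (use tA TG g in \<open>auto simp: inj_on_def\<close>)
  also have "\<dots> = finsum A (\<lambda>h. u \<otimes>\<^bsub>A\<^esub> f h) ?F"
    by (rule A.finsum_cong') (use g fc u(2) in \<open>auto simp: t_def simp flip: G.m_assoc\<close>)
  also have "\<dots> = u \<otimes>\<^bsub>A\<^esub> inv\<^bsub>A\<^esub> u"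
    unfolding v by (rule A.finsum_rdistr[symmetric]) (use fin fc u(2) in auto)
  also have "\<dots> = \<one>\<^bsub>A\<^esub>"
    using u(2) by simp
  also have "\<one>\<^bsub>A\<^esub> = finsum A (\<lambda>k. if \<one>\<^bsub>G\<^esub> = k then \<one>\<^bsub>A\<^esub> else \<zero>\<^bsub>A\<^esub>) (insert \<one>\<^bsub>G\<^esub> ?T)"
    by (rule A.finsum_singleton[symmetric]) (use TG in auto)
  also have "\<dots> = finsum A d (insert \<one>\<^bsub>G\<^esub> ?T)"
    by (rule A.finsum_cong') (use TG in \<open>auto simp: d_def\<close>)
  finally have "t = d"
    by (intro decomp_unique[OF _ _ t d]) (use TG t0 in \<open>auto simp: d_def\<close>)
  then have "t \<one>\<^bsub>G\<^esub> = \<one>\<^bsub>A\<^esub>" by (simp add: d_def)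
  then have "u \<otimes>\<^bsub>A\<^esub> f (inv\<^bsub>G\<^esub> g) = \<one>\<^bsub>A\<^esub>" using g by (simp add: t_def)
  then have "f (inv\<^bsub>G\<^esub> g) = inv\<^bsub>A\<^esub> u"
    using u(2) fc g by (metis A.Units_closed A.Units_inv_closed A.Units_l_inv A.inv_unique G.inv_closed)
  then show ?thesis using fc(1)[of "inv\<^bsub>G\<^esub> g"] g by simp
qed

text \<open>The inverse of \<open>\<beta> b\<close> is given only in \<open>A\<close>; by
  \<open>inv_component\<close> it has degree one and therefore comes from \<open>B\<close>. This is
  what makes \<open>\<omega>\<close>, and the quotient of two sections, take values in the units of
  \<open>B\<close>.\<close>

lemma Units_base:
  assumes b: "b \<in> carrier B" "\<beta> b \<in> Units A"
  shows "b \<in> Units B"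
proof -
  have "inv\<^bsub>A\<^esub> (\<beta> b) \<in> component X \<one>\<^bsub>G\<^esub>"
    using inv_component[of "\<one>\<^bsub>G\<^esub>" "\<beta> b"] b by simp
  then obtain c where c: "c \<in> carrier B" "inv\<^bsub>A\<^esub> (\<beta> b) = \<beta> c"
    by (rule base_surj)
  have "\<beta> (b \<otimes>\<^bsub>B\<^esub> c) = \<beta> \<one>\<^bsub>B\<^esub>" "\<beta> (c \<otimes>\<^bsub>B\<^esub> b) = \<beta> \<one>\<^bsub>B\<^esub>"
    using b c by (simp_all flip: c(2))
  then have "b \<otimes>\<^bsub>B\<^esub> c = \<one>\<^bsub>B\<^esub>" "c \<otimes>\<^bsub>B\<^esub> b = \<one>\<^bsub>B\<^esub>"
    using b c by (simp_all add: base_eq_iff del: base_simps)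
  then show ?thesis using b(1) c(1) unfolding Units_def by blast
qed

lemma base_Units [simp]: "b \<in> Units B \<Longrightarrow> \<beta> b \<in> Units A"
  by (rule alg_hom_Units[OF base_hom])

lemma sections_nonempty: "sections G X \<noteq> {}"
proof -
  have "\<forall>g\<in>carrier G. \<exists>u. u \<in> component X g \<inter> Units A"
    using X unfolding crossed_products_def by blast
  then obtain s where s: "\<forall>g\<in>carrier G. s g \<in> component X g \<inter> Units A"
    by metis
  have "\<one>\<^bsub>A\<^esub> \<in> component X \<one>\<^bsub>G\<^esub>"
    using base_component[OF B.one_closed] by simp
  with s have "(\<lambda>g\<in>carrier G. if g = \<one>\<^bsub>G\<^esub> then \<one>\<^bsub>A\<^esub> else s g) \<in> sections G X"
    by (auto simp: sections_def)
  then show ?thesis by blast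
qed

end

section \<open>The factor system of a section\<close>

locale crossed_product_section = crossed_product G B X
  for G :: "('g, 'm) monoid_scheme" and B :: "(complex, 'b, 'n) module_scheme"
    and X :: "('g, 'b, 'a) graded_alg" +
  fixes \<sigma> :: "'g \<Rightarrow> 'a"
  assumes \<sigma>: "\<sigma> \<in> sections G X"
begin

lemma \<sigma>_simps [simp]:
  shows "g \<in> carrier G \<Longrightarrow> \<sigma> g \<in> component X g"
    and "g \<in> carrier G \<Longrightarrow> \<sigma> g \<in> Units A"
    and "g \<in> carrier G \<Longrightarrow> \<sigma> g \<in> carrier A"
    and "\<sigma> \<one>\<^bsub>G\<^esub> = \<one>\<^bsub>A\<^esub>"
  using \<sigma> by (auto simp: sections_def PiE_iff)

lemma \<sigma>_cancel:
  assumes "g \<in> carrier G" "x \<in> carrier A" "y \<in> carrier A" "x \<otimes>\<^bsub>A\<^esub> \<sigma> g = y \<otimes>\<^bsub>A\<^esub> \<sigma> g"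
  shows "x = y"
proof -
  have "x \<otimes>\<^bsub>A\<^esub> \<sigma> g \<otimes>\<^bsub>A\<^esub> inv\<^bsub>A\<^esub> \<sigma> g = y \<otimes>\<^bsub>A\<^esub> \<sigma> g \<otimes>\<^bsub>A\<^esub> inv\<^bsub>A\<^esub> \<sigma> g"
    using assms(4) by simp
  then show ?thesis using assms(1-3) by (simp add: A.m_assoc)
qed

lemma base_\<sigma>_cancel:
  assumes "g \<in> carrier G" "b \<in> carrier B" "c \<in> carrier B"
    "\<beta> b \<otimes>\<^bsub>A\<^esub> \<sigma> g = \<beta> c \<otimes>\<^bsub>A\<^esub> \<sigma> g"
  shows "b = c"
  using \<sigma>_cancel[OF assms(1) _ _ assms(4)] assms(2,3) by (simp add: base_eq_iff)

text \<open>Since \<open>\<sigma> g\<close> is a unit and \<open>\<beta>\<close> is injective, the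
  two product equations determine the pair. They replace the defining formulas wherever a factor
  system has to be identified: for a changed section, for the twisted algebra and for an equivalent
  crossed product.\<close>

lemma factor_system_eqI:
  assumes S: "S \<in> extensional (carrier G)" "\<And>g. g \<in> carrier G \<Longrightarrow> S g \<in> extensional (carrier B)"
      "\<And>g b. \<lbrakk>g \<in> carrier G; b \<in> carrier B\<rbrakk> \<Longrightarrow> S g b \<in> carrier B"
      "\<And>g b. \<lbrakk>g \<in> carrier G; b \<in> carrier B\<rbrakk> \<Longrightarrow> \<beta> (S g b) \<otimes>\<^bsub>A\<^esub> \<sigma> g = \<sigma> g \<otimes>\<^bsub>A\<^esub> \<beta> b"
    and \<omega>: "\<omega> \<in> extensional (carrier G \<times> carrier G)"
      "\<And>g h. \<lbrakk>g \<in> carrier G; h \<in> carrier G\<rbrakk> \<Longrightarrow> \<omega> (g, h) \<in> carrier B"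
      "\<And>g h. \<lbrakk>g \<in> carrier G; h \<in> carrier G\<rbrakk> \<Longrightarrow>
        \<beta> (\<omega> (g, h)) \<otimes>\<^bsub>A\<^esub> \<sigma> (g \<otimes>\<^bsub>G\<^esub> h) = \<sigma> g \<otimes>\<^bsub>A\<^esub> \<sigma> h"
  shows "factor_system G B X \<sigma> = (S, \<omega>)"
proof -
  have inv: "inv_into (carrier B) \<beta> (x \<otimes>\<^bsub>A\<^esub> inv\<^bsub>A\<^esub> \<sigma> g) = b"
    if "g \<in> carrier G" "b \<in> carrier B" "\<beta> b \<otimes>\<^bsub>A\<^esub> \<sigma> g = x" for g b x
  proof -
    have "x \<otimes>\<^bsub>A\<^esub> inv\<^bsub>A\<^esub> \<sigma> g = \<beta> b"
      unfolding that(3)[symmetric] using that(1,2) by (simp add: A.m_assoc)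
    then show ?thesis
      using base_bij that(2) by (simp add: bij_betw_def)
  qed
  show ?thesis
    unfolding factor_system_def using S \<omega> inv
    by (auto simp: fun_eq_iff restrict_def extensional_def)
qed

definition S where "S = fst (factor_system G B X \<sigma>)"
definition \<omega> where "\<omega> = snd (factor_system G B X \<sigma>)"

lemma factor_system_eq: "factor_system G B X \<sigma> = (S, \<omega>)"
  by (simp add: S_def \<omega>_def)

text \<open>The conjugate has degree \<open>g 1 (inv g) = 1\<close>, hence lies in the image of
  \<open>\<beta>\<close>, where \<open>inv_into\<close> is a genuine inverse.\<close>

lemma S_base:
  assumes "g \<in> carrier G" "b \<in> carrier B"
  shows "S g b \<in> carrier B" "\<beta> (S g b) = \<sigma> g \<otimes>\<^bsub>A\<^esub> \<beta> b \<otimes>\<^bsub>A\<^esub> inv\<^bsub>A\<^esub> \<sigma> g"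
    "\<beta> (S g b) \<otimes>\<^bsub>A\<^esub> \<sigma> g = \<sigma> g \<otimes>\<^bsub>A\<^esub> \<beta> b"
proof -
  have "\<sigma> g \<otimes>\<^bsub>A\<^esub> \<beta> b \<otimes>\<^bsub>A\<^esub> inv\<^bsub>A\<^esub> \<sigma> g \<in> component X (g \<otimes>\<^bsub>G\<^esub> \<one>\<^bsub>G\<^esub> \<otimes>\<^bsub>G\<^esub> inv\<^bsub>G\<^esub> g)"
    using assms inv_component by (intro component_mult) auto
  with assms show *: "S g b \<in> carrier B" "\<beta> (S g b) = \<sigma> g \<otimes>\<^bsub>A\<^esub> \<beta> b \<otimes>\<^bsub>A\<^esub> inv\<^bsub>A\<^esub> \<sigma> g"
    by (simp_all add: S_def factor_system_def inv_into_base)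
  show "\<beta> (S g b) \<otimes>\<^bsub>A\<^esub> \<sigma> g = \<sigma> g \<otimes>\<^bsub>A\<^esub> \<beta> b"
    using assms by (simp add: *(2) A.m_assoc)
qed

lemma \<omega>_base:
  assumes "g \<in> carrier G" "h \<in> carrier G"
  shows "\<omega> (g, h) \<in> Units B" "\<beta> (\<omega> (g, h)) \<otimes>\<^bsub>A\<^esub> \<sigma> (g \<otimes>\<^bsub>G\<^esub> h) = \<sigma> g \<otimes>\<^bsub>A\<^esub> \<sigma> h"
proof -
  let ?x = "\<sigma> g \<otimes>\<^bsub>A\<^esub> \<sigma> h \<otimes>\<^bsub>A\<^esub> inv\<^bsub>A\<^esub> \<sigma> (g \<otimes>\<^bsub>G\<^esub> h)"
  have "?x \<in> component X (g \<otimes>\<^bsub>G\<^esub> h \<otimes>\<^bsub>G\<^esub> inv\<^bsub>G\<^esub> (g \<otimes>\<^bsub>G\<^esub> h))"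
    using assms by (intro component_mult inv_component) auto
  with assms have *: "\<omega> (g, h) \<in> carrier B" "\<beta> (\<omega> (g, h)) = ?x"
    by (simp_all add: \<omega>_def factor_system_def inv_into_base)
  then show "\<omega> (g, h) \<in> Units B"
    using assms by (intro Units_base) (simp_all add: A.Units_m_closed)
  show "\<beta> (\<omega> (g, h)) \<otimes>\<^bsub>A\<^esub> \<sigma> (g \<otimes>\<^bsub>G\<^esub> h) = \<sigma> g \<otimes>\<^bsub>A\<^esub> \<sigma> h"
    using assms by (simp add: *(2) A.m_assoc)
qed

text \<open>Every law of a homomorphism is checked in \<open>A\<close> after multiplication by
  \<open>\<sigma> g\<close>, where \<open>S g b\<close> becomes \<open>b\<close> on the other side
  of \<open>\<sigma> g\<close>.\<close>

lemma S_alg_iso: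
  assumes g: "g \<in> carrier G"
  shows "S g \<in> alg_iso B B"
proof -
  note c = S_base(1)[OF g] and e = S_base(3)[OF g]
  have hom: "S g \<in> alg_hom B B"
  proof (rule alg_homI)
    fix x y assume xy: "x \<in> carrier B" "y \<in> carrier B"
    show "S g (x \<otimes>\<^bsub>B\<^esub> y) = S g x \<otimes>\<^bsub>B\<^esub> S g y"
    proof (rule base_\<sigma>_cancel[OF g])
      have "\<beta> (S g x \<otimes>\<^bsub>B\<^esub> S g y) \<otimes>\<^bsub>A\<^esub> \<sigma> g = \<beta> (S g x) \<otimes>\<^bsub>A\<^esub> (\<beta> (S g y) \<otimes>\<^bsub>A\<^esub> \<sigma> g)"
        using xy c g by (simp add: A.m_assoc)
      also have "\<dots> = \<beta> (S g x) \<otimes>\<^bsub>A\<^esub> \<sigma> g \<otimes>\<^bsub>A\<^esub> \<beta> y"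
        unfolding e[OF xy(2)] using xy c g by (simp add: A.m_assoc)
      also have "\<dots> = \<sigma> g \<otimes>\<^bsub>A\<^esub> \<beta> x \<otimes>\<^bsub>A\<^esub> \<beta> y"
        using xy by (simp only: e)
      also have "\<dots> = \<beta> (S g (x \<otimes>\<^bsub>B\<^esub> y)) \<otimes>\<^bsub>A\<^esub> \<sigma> g"
        using xy g e by (simp add: e A.m_assoc)
      finally show "\<beta> (S g (x \<otimes>\<^bsub>B\<^esub> y)) \<otimes>\<^bsub>A\<^esub> \<sigma> g = \<beta> (S g x \<otimes>\<^bsub>B\<^esub> S g y) \<otimes>\<^bsub>A\<^esub> \<sigma> g" ..
    qed (use xy c in simp_all)
    show "S g (x \<oplus>\<^bsub>B\<^esub> y) = S g x \<oplus>\<^bsub>B\<^esub> S g y"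
      by (rule base_\<sigma>_cancel[OF g]) (use xy c g e in \<open>simp_all add: A.l_distr A.r_distr\<close>)
  next
    fix a x assume x: "x \<in> carrier B"
    show "S g (a \<odot>\<^bsub>B\<^esub> x) = a \<odot>\<^bsub>B\<^esub> S g x"
      by (rule base_\<sigma>_cancel[OF g])
        (use x c g e B.smult_closed in \<open>simp_all add: A.smult_mult_left A.smult_mult_right\<close>)
  next
    show "S g \<one>\<^bsub>B\<^esub> = \<one>\<^bsub>B\<^esub>"
      by (rule base_\<sigma>_cancel[OF g]) (use c g e in simp_all)
  qed (rule c)
  moreover have "bij_betw (S g) (carrier B) (carrier B)"
  proof (rule bij_betw_imageI)
    show "inj_on (S g) (carrier B)"
    proof (rule inj_onI)
      fix x y assume xy: "x \<in> carrier B" "y \<in> carrier B" "S g x = S g y"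
      then have "\<sigma> g \<otimes>\<^bsub>A\<^esub> \<beta> x = \<sigma> g \<otimes>\<^bsub>A\<^esub> \<beta> y"
        using e by metis
      then show "x = y"
        using xy g by (simp add: base_eq_iff)
    qed
    have "b \<in> S g ` carrier B" if b: "b \<in> carrier B" for b
    proof -
      \<comment> \<open>A preimage of \<open>b\<close> is obtained by conjugating in the opposite
        direction, which again stays in degree one.\<close>
      have "inv\<^bsub>A\<^esub> \<sigma> g \<otimes>\<^bsub>A\<^esub> \<beta> b \<otimes>\<^bsub>A\<^esub> \<sigma> g \<in> component X (inv\<^bsub>G\<^esub> g \<otimes>\<^bsub>G\<^esub> \<one>\<^bsub>G\<^esub> \<otimes>\<^bsub>G\<^esub> g)"
        using b g by (intro component_mult inv_component) auto
      then have "inv\<^bsub>A\<^esub> \<sigma> g \<otimes>\<^bsub>A\<^esub> \<beta> b \<otimes>\<^bsub>A\<^esub> \<sigma> g \<in> component X \<one>\<^bsub>G\<^esub>"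
        using g by simp
      then obtain x where x: "x \<in> carrier B" "inv\<^bsub>A\<^esub> \<sigma> g \<otimes>\<^bsub>A\<^esub> \<beta> b \<otimes>\<^bsub>A\<^esub> \<sigma> g = \<beta> x"
        by (rule base_surj)
      have "\<beta> (S g x) \<otimes>\<^bsub>A\<^esub> \<sigma> g = \<sigma> g \<otimes>\<^bsub>A\<^esub> inv\<^bsub>A\<^esub> \<sigma> g \<otimes>\<^bsub>A\<^esub> \<beta> b \<otimes>\<^bsub>A\<^esub> \<sigma> g"
        using x(1) e g b by (simp add: x(2)[symmetric] A.m_assoc del: A.Units_r_inv)
      also have "\<dots> = \<beta> b \<otimes>\<^bsub>A\<^esub> \<sigma> g" using g b by simp
      finally have "S g x = b"
        using base_\<sigma>_cancel[OF g c[OF x(1)] b] by simp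
      then show ?thesis using x(1) by blast
    qed
    then show "S g ` carrier B = carrier B" using c by auto
  qed
  ultimately show ?thesis by (simp add: alg_iso_def)
qed

text \<open>Both conditions express associativity in \<open>A\<close>: the first compares two ways
  of moving \<open>\<beta> b\<close> through \<open>\<sigma> g \<sigma> h\<close>, the second the
  two bracketings of \<open>\<sigma> g \<sigma> h \<sigma> k\<close>. The common right factor,
  \<open>\<sigma> (g h)\<close> or \<open>\<sigma> (g h k)\<close>, is then cancelled.\<close>

lemma factor_system_Z2: "(S, \<omega>) \<in> Z2 G B"
proof -
  have "S \<in> carrier G \<rightarrow>\<^sub>E alg_iso B B \<inter> extensional (carrier B)"
    using S_alg_iso by (auto simp: S_def factor_system_def)
  moreover have "S \<one>\<^bsub>G\<^esub> = (\<lambda>b\<in>carrier B. b)"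
  proof (rule extensionalityI[of _ "carrier B"])
    fix b assume b: "b \<in> carrier B"
    have "\<beta> (S \<one>\<^bsub>G\<^esub> b) = \<beta> b" using b by (simp add: S_base)
    then show "S \<one>\<^bsub>G\<^esub> b = (\<lambda>b\<in>carrier B. b) b"
      using b base_eq_iff[OF S_base(1)[OF G.one_closed b] b] by simp
  qed (auto simp: S_def factor_system_def)
  moreover have "\<omega> \<in> carrier G \<times> carrier G \<rightarrow>\<^sub>E Units B"
    using \<omega>_base(1) by (auto simp: PiE_iff) (auto simp: \<omega>_def factor_system_def)
  moreover have "\<omega> (g, \<one>\<^bsub>G\<^esub>) = \<one>\<^bsub>B\<^esub> \<and> \<omega> (\<one>\<^bsub>G\<^esub>, g) = \<one>\<^bsub>B\<^esub>" if g: "g \<in> carrier G" for g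
    using \<omega>_base[of g "\<one>\<^bsub>G\<^esub>"] \<omega>_base[of "\<one>\<^bsub>G\<^esub>" g] g by (auto intro!: base_\<sigma>_cancel[OF g])
  moreover have "S g (S h b) \<otimes>\<^bsub>B\<^esub> \<omega> (g, h) = \<omega> (g, h) \<otimes>\<^bsub>B\<^esub> S (g \<otimes>\<^bsub>G\<^esub> h) b"
    if gh: "g \<in> carrier G" "h \<in> carrier G" and b: "b \<in> carrier B" for g h b
  proof (rule base_\<sigma>_cancel[of "g \<otimes>\<^bsub>G\<^esub> h"])
    have w: "\<omega> (g, h) \<in> carrier B" using \<omega>_base(1)[OF gh] by simp
    have "\<beta> (S g (S h b) \<otimes>\<^bsub>B\<^esub> \<omega> (g, h)) \<otimes>\<^bsub>A\<^esub> \<sigma> (g \<otimes>\<^bsub>G\<^esub> h) = \<beta> (S g (S h b)) \<otimes>\<^bsub>A\<^esub> \<sigma> g \<otimes>\<^bsub>A\<^esub> \<sigma> h"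
      using gh b w \<omega>_base(2)[OF gh] by (simp add: A.m_assoc S_base(1))
    also have "\<dots> = \<sigma> g \<otimes>\<^bsub>A\<^esub> (\<beta> (S h b) \<otimes>\<^bsub>A\<^esub> \<sigma> h)"
      using gh b by (simp add: S_base(1) S_base(3)[of g] A.m_assoc)
    also have "\<dots> = \<sigma> g \<otimes>\<^bsub>A\<^esub> \<sigma> h \<otimes>\<^bsub>A\<^esub> \<beta> b"
      using gh b by (simp add: S_base(3) A.m_assoc)
    also have "\<dots> = \<beta> (\<omega> (g, h)) \<otimes>\<^bsub>A\<^esub> (\<sigma> (g \<otimes>\<^bsub>G\<^esub> h) \<otimes>\<^bsub>A\<^esub> \<beta> b)"
      using gh b w by (simp add: A.m_assoc flip: \<omega>_base(2))
    also have "\<dots> = \<beta> (\<omega> (g, h) \<otimes>\<^bsub>B\<^esub> S (g \<otimes>\<^bsub>G\<^esub> h) b) \<otimes>\<^bsub>A\<^esub> \<sigma> (g \<otimes>\<^bsub>G\<^esub> h)"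
      using gh b w by (simp add: A.m_assoc S_base(1) flip: S_base(3))
    finally show "\<beta> (S g (S h b) \<otimes>\<^bsub>B\<^esub> \<omega> (g, h)) \<otimes>\<^bsub>A\<^esub> \<sigma> (g \<otimes>\<^bsub>G\<^esub> h) =
      \<beta> (\<omega> (g, h) \<otimes>\<^bsub>B\<^esub> S (g \<otimes>\<^bsub>G\<^esub> h) b) \<otimes>\<^bsub>A\<^esub> \<sigma> (g \<otimes>\<^bsub>G\<^esub> h)" .
  qed (use gh b S_base(1) \<omega>_base(1)[OF gh] in auto)
  moreover have "S g (\<omega> (h, k)) \<otimes>\<^bsub>B\<^esub> \<omega> (g, h \<otimes>\<^bsub>G\<^esub> k) = \<omega> (g, h) \<otimes>\<^bsub>B\<^esub> \<omega> (g \<otimes>\<^bsub>G\<^esub> h, k)"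
    if ghk: "g \<in> carrier G" "h \<in> carrier G" "k \<in> carrier G" for g h k
  proof (rule base_\<sigma>_cancel[of "g \<otimes>\<^bsub>G\<^esub> (h \<otimes>\<^bsub>G\<^esub> k)"])
    have w: "\<omega> (x, y) \<in> carrier B" if "x \<in> carrier G" "y \<in> carrier G" for x y
      using \<omega>_base(1)[OF that] by simp
    have "\<beta> (S g (\<omega> (h, k)) \<otimes>\<^bsub>B\<^esub> \<omega> (g, h \<otimes>\<^bsub>G\<^esub> k)) \<otimes>\<^bsub>A\<^esub> \<sigma> (g \<otimes>\<^bsub>G\<^esub> (h \<otimes>\<^bsub>G\<^esub> k))
        = \<beta> (S g (\<omega> (h, k))) \<otimes>\<^bsub>A\<^esub> \<sigma> g \<otimes>\<^bsub>A\<^esub> \<sigma> (h \<otimes>\<^bsub>G\<^esub> k)"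
      using ghk w by (simp add: A.m_assoc S_base(1) \<omega>_base(2))
    also have "\<dots> = \<sigma> g \<otimes>\<^bsub>A\<^esub> (\<beta> (\<omega> (h, k)) \<otimes>\<^bsub>A\<^esub> \<sigma> (h \<otimes>\<^bsub>G\<^esub> k))"
      using ghk w by (simp add: A.m_assoc S_base(3))
    also have "\<dots> = \<sigma> g \<otimes>\<^bsub>A\<^esub> \<sigma> h \<otimes>\<^bsub>A\<^esub> \<sigma> k"
      using ghk by (simp add: \<omega>_base(2) A.m_assoc)
    also have "\<dots> = \<beta> (\<omega> (g, h)) \<otimes>\<^bsub>A\<^esub> (\<sigma> (g \<otimes>\<^bsub>G\<^esub> h) \<otimes>\<^bsub>A\<^esub> \<sigma> k)"
      using ghk w by (simp add: A.m_assoc flip: \<omega>_base(2)[of g h])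
    also have "\<dots> = \<beta> (\<omega> (g, h) \<otimes>\<^bsub>B\<^esub> \<omega> (g \<otimes>\<^bsub>G\<^esub> h, k)) \<otimes>\<^bsub>A\<^esub> \<sigma> (g \<otimes>\<^bsub>G\<^esub> (h \<otimes>\<^bsub>G\<^esub> k))"
      using ghk w by (simp add: A.m_assoc G.m_assoc flip: \<omega>_base(2)[of "g \<otimes>\<^bsub>G\<^esub> h" k])
    finally show "\<beta> (S g (\<omega> (h, k)) \<otimes>\<^bsub>B\<^esub> \<omega> (g, h \<otimes>\<^bsub>G\<^esub> k)) \<otimes>\<^bsub>A\<^esub> \<sigma> (g \<otimes>\<^bsub>G\<^esub> (h \<otimes>\<^bsub>G\<^esub> k)) =
      \<beta> (\<omega> (g, h) \<otimes>\<^bsub>B\<^esub> \<omega> (g \<otimes>\<^bsub>G\<^esub> h, k)) \<otimes>\<^bsub>A\<^esub> \<sigma> (g \<otimes>\<^bsub>G\<^esub> (h \<otimes>\<^bsub>G\<^esub> k))" .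
  qed (use ghk S_base(1) \<omega>_base(1) in auto)
  ultimately show ?thesis
    unfolding Z2_iff by blast
qed

sublocale factor_pair G B S \<omega>
  by unfold_locales (rule factor_system_Z2)

section \<open>Change of section\<close>

definition shift :: "('g \<Rightarrow> 'b) \<Rightarrow> 'g \<Rightarrow> 'a"
  where "shift h = (\<lambda>g\<in>carrier G. \<beta> (h g) \<otimes>\<^bsub>A\<^esub> \<sigma> g)"

lemma C1_units:
  assumes "h \<in> C1 G (units_of B)"
  shows "g \<in> carrier G \<Longrightarrow> h g \<in> Units B" "g \<in> carrier G \<Longrightarrow> h g \<in> carrier B" "h \<one>\<^bsub>G\<^esub> = \<one>\<^bsub>B\<^esub>"
  using assms by (auto simp: C1_def units_of_carrier units_of_one)

lemma shift_sections:
  assumes h: "h \<in> C1 G (units_of B)"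
  shows "shift h \<in> sections G X"
proof -
  note h = C1_units[OF h]
  have "\<beta> (h g) \<otimes>\<^bsub>A\<^esub> \<sigma> g \<in> component X g" if "g \<in> carrier G" for g
    using component_mult[of "\<beta> (h g)" "\<one>\<^bsub>G\<^esub>" "\<sigma> g" g] that h by simp
  then show ?thesis
    using h by (auto simp: sections_def shift_def A.Units_m_closed)
qed

text \<open>The formulas of the action record what replacing \<open>\<sigma>\<close> by
  \<open>h \<sigma>\<close> does. Conjugation by \<open>h g \<sigma> g\<close> is the new first
  entry; in the product of \<open>h g \<sigma> g\<close> and \<open>h k \<sigma> k\<close>, moving
  \<open>h k\<close> past \<open>\<sigma> g\<close> produces \<open>S g (h k)\<close>, and splitting
  off the new section at \<open>g k\<close> produces the inverse of \<open>h (g k)\<close>.\<close>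

lemma Z2_act_factor_system:
  assumes h: "h \<in> C1 G (units_of B)"
  shows "Z2_act G B h (S, \<omega>) = factor_system G B X (shift h)"
proof -
  interpret T: crossed_product_section G B X "shift h"
    by unfold_locales (rule shift_sections[OF h])
  note hu = C1_units[OF h]
  define S' where "S' = (\<lambda>g\<in>carrier G. conj_aut B (h g) \<otimes>\<^bsub>Aut B\<^esub> S g)"
  define \<omega>' where "\<omega>' = (\<lambda>(g, g')\<in>carrier G \<times> carrier G.
       h g \<otimes>\<^bsub>B\<^esub> S g (h g') \<otimes>\<^bsub>B\<^esub> \<omega> (g, g') \<otimes>\<^bsub>B\<^esub> inv\<^bsub>B\<^esub> (h (g \<otimes>\<^bsub>G\<^esub> g')))"
  have SAut: "S g \<in> carrier (Aut B)" if "g \<in> carrier G" for g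
    using Z2 that unfolding Z2_iff by (auto simp: B.Aut_carrier)
  have S'_eq: "S' g = compose (carrier B) (conj_aut B (h g)) (S g)" if "g \<in> carrier G" for g
    using that hu SAut B.conj_aut_Aut by (simp add: S'_def B.Aut_mult)
  then have S'_apply: "S' g b = h g \<otimes>\<^bsub>B\<^esub> S g b \<otimes>\<^bsub>B\<^esub> inv\<^bsub>B\<^esub> (h g)"
    if "g \<in> carrier G" "b \<in> carrier B" for g b
    using that by (simp add: compose_def conj_aut_def)
  have "factor_system G B X (shift h) = (S', \<omega>')"
  proof (rule T.factor_system_eqI)
    show "S' \<in> extensional (carrier G)" "\<omega>' \<in> extensional (carrier G \<times> carrier G)"
      by (simp_all add: S'_def \<omega>'_def)
  next
    fix g assume g: "g \<in> carrier G"
    show "S' g \<in> extensional (carrier B)"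
      using g by (simp add: S'_eq)
    fix b assume b: "b \<in> carrier B"
    show "S' g b \<in> carrier B"
      using g b hu by (simp add: S'_apply)
    then have "\<beta> (S' g b) \<otimes>\<^bsub>A\<^esub> shift h g = \<beta> (S' g b \<otimes>\<^bsub>B\<^esub> h g) \<otimes>\<^bsub>A\<^esub> \<sigma> g"
      using g hu by (simp add: shift_def A.m_assoc)
    also have "S' g b \<otimes>\<^bsub>B\<^esub> h g = h g \<otimes>\<^bsub>B\<^esub> S g b"
      using g b hu by (simp add: S'_apply B.m_assoc)
    also have "\<beta> \<dots> \<otimes>\<^bsub>A\<^esub> \<sigma> g = \<beta> (h g) \<otimes>\<^bsub>A\<^esub> (\<beta> (S g b) \<otimes>\<^bsub>A\<^esub> \<sigma> g)"
      using g b hu by (simp add: A.m_assoc)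
    also have "\<dots> = shift h g \<otimes>\<^bsub>A\<^esub> \<beta> b"
      unfolding S_base(3)[OF g b] using g b hu by (simp add: shift_def A.m_assoc)
    finally show "\<beta> (S' g b) \<otimes>\<^bsub>A\<^esub> shift h g = shift h g \<otimes>\<^bsub>A\<^esub> \<beta> b" .
  next
    fix g k assume gk: "g \<in> carrier G" "k \<in> carrier G"
    then have \<omega>'_apply: "\<omega>' (g, k) =
        h g \<otimes>\<^bsub>B\<^esub> S g (h k) \<otimes>\<^bsub>B\<^esub> \<omega> (g, k) \<otimes>\<^bsub>B\<^esub> inv\<^bsub>B\<^esub> (h (g \<otimes>\<^bsub>G\<^esub> k))"
      by (simp add: \<omega>'_def)
    show c: "\<omega>' (g, k) \<in> carrier B"
      using gk hu by (simp add: \<omega>'_apply)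
    have "\<beta> (\<omega>' (g, k)) \<otimes>\<^bsub>A\<^esub> shift h (g \<otimes>\<^bsub>G\<^esub> k)
        = \<beta> (\<omega>' (g, k) \<otimes>\<^bsub>B\<^esub> h (g \<otimes>\<^bsub>G\<^esub> k)) \<otimes>\<^bsub>A\<^esub> \<sigma> (g \<otimes>\<^bsub>G\<^esub> k)"
      using gk hu c by (simp add: shift_def A.m_assoc)
    also have "\<omega>' (g, k) \<otimes>\<^bsub>B\<^esub> h (g \<otimes>\<^bsub>G\<^esub> k) = h g \<otimes>\<^bsub>B\<^esub> S g (h k) \<otimes>\<^bsub>B\<^esub> \<omega> (g, k)"
      using gk hu by (simp add: \<omega>'_apply B.m_assoc)
    also have "\<beta> \<dots> \<otimes>\<^bsub>A\<^esub> \<sigma> (g \<otimes>\<^bsub>G\<^esub> k) = \<beta> (h g) \<otimes>\<^bsub>A\<^esub> (\<beta> (S g (h k)) \<otimes>\<^bsub>A\<^esub> \<sigma> g) \<otimes>\<^bsub>A\<^esub> \<sigma> k"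
      using gk hu by (simp add: A.m_assoc \<omega>_base(2))
    also have "\<dots> = shift h g \<otimes>\<^bsub>A\<^esub> shift h k"
      unfolding S_base(3)[OF gk(1) hu(2)[OF gk(2)]]
      using gk hu by (simp add: shift_def A.m_assoc)
    finally show "\<beta> (\<omega>' (g, k)) \<otimes>\<^bsub>A\<^esub> shift h (g \<otimes>\<^bsub>G\<^esub> k) = shift h g \<otimes>\<^bsub>A\<^esub> shift h k" .
  qed
  then show ?thesis
    using Z2 by (simp add: Z2_act_def S'_def \<omega>'_def)
qed

text \<open>The quotient of two units of the same degree has degree one, so it comes from a unit of
  \<open>B\<close>.\<close>

lemma shift_surj:
  assumes t: "\<tau> \<in> sections G X"
  obtains h where "h \<in> C1 G (units_of B)" "shift h = \<tau>"
proof -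
  interpret T: crossed_product_section G B X \<tau>
    by unfold_locales (rule t)
  define h where "h = (\<lambda>g\<in>carrier G. inv_into (carrier B) \<beta> (\<tau> g \<otimes>\<^bsub>A\<^esub> inv\<^bsub>A\<^esub> \<sigma> g))"
  have h: "h g \<in> carrier B" "\<beta> (h g) = \<tau> g \<otimes>\<^bsub>A\<^esub> inv\<^bsub>A\<^esub> \<sigma> g" if g: "g \<in> carrier G" for g
  proof -
    have "\<tau> g \<otimes>\<^bsub>A\<^esub> inv\<^bsub>A\<^esub> \<sigma> g \<in> component X (g \<otimes>\<^bsub>G\<^esub> inv\<^bsub>G\<^esub> g)"
      using g by (intro component_mult inv_component) auto
    then show "h g \<in> carrier B" "\<beta> (h g) = \<tau> g \<otimes>\<^bsub>A\<^esub> inv\<^bsub>A\<^esub> \<sigma> g"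
      using g by (simp_all add: h_def inv_into_base)
  qed
  have "h g \<in> Units B" if "g \<in> carrier G" for g
    using h that by (intro Units_base) (simp_all add: A.Units_m_closed)
  moreover have "h \<one>\<^bsub>G\<^esub> = \<one>\<^bsub>B\<^esub>"
    using base_eq_iff[OF h(1)[OF G.one_closed] B.one_closed] h(2)[of "\<one>\<^bsub>G\<^esub>"] by simp
  ultimately have C1: "h \<in> C1 G (units_of B)"
    by (auto simp: C1_def units_of_carrier units_of_one h_def)
  have "shift h = \<tau>"
  proof (rule extensionalityI[of _ "carrier G"])
    show "shift h \<in> extensional (carrier G)" by (simp add: shift_def)
    show "\<tau> \<in> extensional (carrier G)" using t by (auto simp: sections_def PiE_iff)
    fix g assume g: "g \<in> carrier G"
    then show "shift h g = \<tau> g"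
      using h(2)[OF g] by (simp add: shift_def A.m_assoc)
  qed
  with C1 show ?thesis by (rule that)
qed

text \<open>The right-hand side does not mention \<open>\<sigma>\<close>: this is the independence
  of the chosen section.\<close>

lemma coh_class_eq: "coh_class G B (factor_system G B X \<sigma>) = factor_system G B X ` sections G X"
proof -
  have "coh_class G B (S, \<omega>) = (\<lambda>h. factor_system G B X (shift h)) ` C1 G (units_of B)"
    unfolding coh_class_def orbit_def Setcompr_eq_image
    by (intro image_cong) (simp_all add: C1_group_def Z2_act_factor_system)
  also have "\<dots> = factor_system G B X ` (shift ` C1 G (units_of B))"
    by (simp add: image_image)
  also have "shift ` C1 G (units_of B) = sections G X"
    by (metis (no_types, lifting) shift_sections shift_surj image_subset_iff image_eqI subsetI subset_antisym)
  finally show ?thesis by (simp add: factor_system_eq)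
qed

section \<open>Comparison with the twisted algebra\<close>

definition \<psi> :: "('g \<Rightarrow> 'b) \<Rightarrow> 'a"
  where "\<psi> f = finsum A (\<lambda>g. \<beta> (f g) \<otimes>\<^bsub>A\<^esub> \<sigma> g) {g \<in> carrier G. f g \<noteq> \<zero>\<^bsub>B\<^esub>}"

lemma \<psi>_eq:
  assumes "f \<in> carrier K" "finite F" "F \<subseteq> carrier G" "{g \<in> carrier G. f g \<noteq> \<zero>\<^bsub>B\<^esub>} \<subseteq> F"
  shows "\<psi> f = finsum A (\<lambda>g. \<beta> (f g) \<otimes>\<^bsub>A\<^esub> \<sigma> g) F"
  unfolding \<psi>_def by (rule A.add.finprod_mono_neutral_cong_left) (use assms in \<open>auto simp: subset_iff\<close>)

lemma \<psi>_closed: "f \<in> carrier K \<Longrightarrow> \<psi> f \<in> carrier A"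
  unfolding \<psi>_def by (rule A.finsum_closed) auto

lemma \<psi>_add:
  assumes f: "f \<in> carrier K" "f' \<in> carrier K"
  shows "\<psi> (f \<oplus>\<^bsub>K\<^esub> f') = \<psi> f \<oplus>\<^bsub>A\<^esub> \<psi> f'"
proof -
  let ?F = "{g \<in> carrier G. f g \<noteq> \<zero>\<^bsub>B\<^esub>} \<union> {g \<in> carrier G. f' g \<noteq> \<zero>\<^bsub>B\<^esub>}"
  have F: "finite ?F" "?F \<subseteq> carrier G"
    using f K_supp by auto
  have sub: "{g \<in> carrier G. (f \<oplus>\<^bsub>K\<^esub> f') g \<noteq> \<zero>\<^bsub>B\<^esub>} \<subseteq> ?F"
    using f by (auto simp: K_apply)
  have "\<psi> (f \<oplus>\<^bsub>K\<^esub> f') = finsum A (\<lambda>g. \<beta> (f g) \<otimes>\<^bsub>A\<^esub> \<sigma> g \<oplus>\<^bsub>A\<^esub> \<beta> (f' g) \<otimes>\<^bsub>A\<^esub> \<sigma> g) ?F"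
    unfolding \<psi>_eq[OF K_closed(1)[OF f] F sub]
    by (rule A.finsum_cong') (use f in \<open>auto simp: K_apply A.l_distr\<close>)
  also have "\<dots> = \<psi> f \<oplus>\<^bsub>A\<^esub> \<psi> f'"
    unfolding \<psi>_eq[OF f(1) F Un_upper1] \<psi>_eq[OF f(2) F Un_upper2]
    by (rule A.finsum_addf) (use f in auto)
  finally show ?thesis .
qed

lemma \<psi>_monom:
  assumes "g \<in> carrier G" "b \<in> carrier B"
  shows "\<psi> (monom G B g b) = \<beta> b \<otimes>\<^bsub>A\<^esub> \<sigma> g"
  using assms by (subst \<psi>_eq[where F = "{g}"]) (auto simp: K_apply split: if_splits)

text \<open>By additivity in both arguments only monomials remain, and for these
  \<open>S_base\<close> moves \<open>\<sigma> g\<close> past \<open>\<beta> c\<close> while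
  \<open>\<omega>_base\<close> merges \<open>\<sigma> g \<sigma> h\<close>.\<close>

lemma \<psi>_mult:
  assumes "x \<in> carrier K" "y \<in> carrier K"
  shows "\<psi> (x \<otimes>\<^bsub>K\<^esub> y) = \<psi> x \<otimes>\<^bsub>A\<^esub> \<psi> y"
  using assms(1)
proof (induction rule: K_induct)
  case (monom g b)
  note gb = monom
  from assms(2) show ?case
  proof (induction rule: K_induct)
    case (monom h c)
    note hc = monom
    have "\<beta> (b \<otimes>\<^bsub>B\<^esub> S g c \<otimes>\<^bsub>B\<^esub> \<omega> (g, h)) \<otimes>\<^bsub>A\<^esub> \<sigma> (g \<otimes>\<^bsub>G\<^esub> h)
        = \<beta> b \<otimes>\<^bsub>A\<^esub> (\<beta> (S g c) \<otimes>\<^bsub>A\<^esub> \<sigma> g) \<otimes>\<^bsub>A\<^esub> \<sigma> h"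
      using gb hc by (simp add: A.m_assoc \<omega>_base(2))
    also have "\<dots> = \<beta> b \<otimes>\<^bsub>A\<^esub> \<sigma> g \<otimes>\<^bsub>A\<^esub> (\<beta> c \<otimes>\<^bsub>A\<^esub> \<sigma> h)"
      unfolding S_base(3)[OF gb(1) hc(2)] using gb hc by (simp add: A.m_assoc)
    finally show ?case
      using gb hc by (simp add: K_monom_mult \<psi>_monom)
  qed (use gb in \<open>simp add: K_r_distr \<psi>_add \<psi>_closed A.r_distr\<close>)
qed (use assms(2) in \<open>simp add: K_l_distr \<psi>_add \<psi>_closed A.l_distr\<close>)

lemma \<psi>_smult: "x \<in> carrier K \<Longrightarrow> \<psi> (c \<odot>\<^bsub>K\<^esub> x) = c \<odot>\<^bsub>A\<^esub> \<psi> x"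
proof (induction rule: K_induct)
  case (monom g b)
  then show ?case
    using B.smult_closed by (simp add: K_smult_monom \<psi>_monom A.smult_mult_left)
next
  case (add f f')
  then show ?case
    using K.smult_r_distr[of c] A.smult_r_distr[of c] by (simp add: \<psi>_add \<psi>_closed)
qed

lemma \<psi>_hom: "\<psi> \<in> alg_hom K A"
  by (rule alg_homI) (simp_all add: \<psi>_closed \<psi>_mult \<psi>_add \<psi>_smult K_one \<psi>_monom)

lemma \<psi>_inj: "inj_on \<psi> (carrier K)"
proof (rule inj_onI)
  fix f f' assume f: "f \<in> carrier K" "f' \<in> carrier K" and eq: "\<psi> f = \<psi> f'"
  let ?F = "{g \<in> carrier G. f g \<noteq> \<zero>\<^bsub>B\<^esub>} \<union> {g \<in> carrier G. f' g \<noteq> \<zero>\<^bsub>B\<^esub>}"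
  \<comment> \<open>The homogeneous components of \<open>\<psi> f\<close>. Over the common index set
    \<open>decomp_unique\<close> applies to both families, and the unit \<open>\<sigma> g\<close>
    then cancels from each component.\<close>
  let ?t = "\<lambda>f. \<lambda>g\<in>carrier G. \<beta> (f g) \<otimes>\<^bsub>A\<^esub> \<sigma> g"
  have F: "finite ?F" "?F \<subseteq> carrier G"
    using f K_supp by auto
  have t: "?t x \<in> (\<Pi>\<^sub>E i\<in>carrier G. component X i)" if "x \<in> carrier K" for x
  proof -
    have "\<beta> (x g) \<otimes>\<^bsub>A\<^esub> \<sigma> g \<in> component X g" if "g \<in> carrier G" for g
      using component_mult[of "\<beta> (x g)" "\<one>\<^bsub>G\<^esub>" "\<sigma> g" g] that \<open>x \<in> _\<close> by simp
    then show ?thesis by auto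
  qed
  have sum: "finsum A (?t x) ?F = finsum A (\<lambda>g. \<beta> (x g) \<otimes>\<^bsub>A\<^esub> \<sigma> g) ?F" if "x \<in> carrier K" for x
    by (rule A.finsum_cong') (use that in auto)
  have "?t f = ?t f'"
  proof (rule decomp_unique[OF F t[OF f(1)] t[OF f(2)]])
    show "finsum A (?t f) ?F = finsum A (?t f') ?F"
      unfolding sum[OF f(1)] sum[OF f(2)]
      using eq \<psi>_eq[OF f(1) F Un_upper1] \<psi>_eq[OF f(2) F Un_upper2] by simp
  qed auto
  then have "\<beta> (f g) \<otimes>\<^bsub>A\<^esub> \<sigma> g = \<beta> (f' g) \<otimes>\<^bsub>A\<^esub> \<sigma> g" if "g \<in> carrier G" for g
    using that by (metis (no_types, lifting) restrict_apply')
  then show "f = f'"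
    using f base_\<sigma>_cancel by (intro K_eqI) auto
qed

text \<open>Right multiplication by the inverse of \<open>\<sigma> g\<close> leads from degree
  \<open>g\<close> to degree one. Together with \<open>base_\<sigma>_cancel\<close> this says that
  each component is a free left \<open>B\<close>-module with basis
  \<open>\<sigma> g\<close>.\<close>

lemma component_eq: "g \<in> carrier G \<Longrightarrow> component X g = (\<lambda>b. \<beta> b \<otimes>\<^bsub>A\<^esub> \<sigma> g) ` carrier B"
proof (intro equalityI subsetI)
  fix x assume g: "g \<in> carrier G" and x: "x \<in> component X g"
  have "x \<otimes>\<^bsub>A\<^esub> inv\<^bsub>A\<^esub> \<sigma> g \<in> component X (g \<otimes>\<^bsub>G\<^esub> inv\<^bsub>G\<^esub> g)"
    using g x by (intro component_mult inv_component) auto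
  then have "x \<otimes>\<^bsub>A\<^esub> inv\<^bsub>A\<^esub> \<sigma> g \<in> component X \<one>\<^bsub>G\<^esub>"
    using g by simp
  then obtain b where b: "b \<in> carrier B" "x \<otimes>\<^bsub>A\<^esub> inv\<^bsub>A\<^esub> \<sigma> g = \<beta> b"
    by (rule base_surj)
  have "\<beta> b \<otimes>\<^bsub>A\<^esub> \<sigma> g = x"
    using g x by (simp add: b(2)[symmetric] A.m_assoc)
  with b(1) show "x \<in> (\<lambda>b. \<beta> b \<otimes>\<^bsub>A\<^esub> \<sigma> g) ` carrier B" by blast
next
  fix x assume g: "g \<in> carrier G" and "x \<in> (\<lambda>b. \<beta> b \<otimes>\<^bsub>A\<^esub> \<sigma> g) ` carrier B"
  then obtain b where "b \<in> carrier B" "x = \<beta> b \<otimes>\<^bsub>A\<^esub> \<sigma> g" by blast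
  then show "x \<in> component X g"
    using component_mult[of "\<beta> b" "\<one>\<^bsub>G\<^esub>" "\<sigma> g" g] g by simp
qed

lemma \<psi>_component: "g \<in> carrier G \<Longrightarrow> \<psi> ` (monom G B g ` carrier B) = component X g"
  by (simp add: component_eq image_image \<psi>_monom cong: image_cong)

lemma \<psi>_surj: "\<psi> ` carrier K = carrier A"
proof (intro equalityI subsetI)
  fix a assume "a \<in> carrier A"
  then obtain f where f: "f \<in> (\<Pi>\<^sub>E i\<in>carrier G. component X i)"
    and fin: "finite {i \<in> carrier G. f i \<noteq> \<zero>\<^bsub>A\<^esub>}"
    and a: "a = finsum A f {i \<in> carrier G. f i \<noteq> \<zero>\<^bsub>A\<^esub>}"
    by (rule decomp_exists)
  let ?F = "{i \<in> carrier G. f i \<noteq> \<zero>\<^bsub>A\<^esub>}"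
  \<comment> \<open>Homogeneous elements have monomial preimages; these are chosen for every degree
    and summed over the finite support of \<open>f\<close>.\<close>
  have "\<exists>x. x \<in> carrier K \<and> \<psi> x = f i" if i: "i \<in> carrier G" for i
    using PiE_mem[OF f i] \<psi>_component[OF i] K_closed(4)[of _ i] by (smt (verit) imageE)
  then obtain x where x: "\<And>i. i \<in> carrier G \<Longrightarrow> x i \<in> carrier K \<and> \<psi> (x i) = f i"
    by metis
  have xK: "x \<in> ?F \<rightarrow> carrier K" using x by auto
  have "\<psi> (finsum K x ?F) = finsum A (\<lambda>i. \<psi> (x i)) ?F"
    by (rule alg_hom_finsum[OF \<psi>_hom K.complex_algebra_axioms A.complex_algebra_axioms xK])
  also have "\<dots> = a"
    unfolding a using x component_closed[OF PiE_mem[OF f]] by (intro A.finsum_cong') auto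
  finally show "a \<in> \<psi> ` carrier K"
    using K.finsum_closed[OF xK] by blast
qed (auto simp: \<psi>_closed)

theorem twisted_cp_equiv: "cp_equiv G B KX X"
proof -
  have "\<psi> \<in> alg_iso K A"
    using \<psi>_hom \<psi>_inj \<psi>_surj by (simp add: alg_iso_def bij_betw_def)
  then show ?thesis
    unfolding cp_equiv_def using \<psi>_component \<psi>_monom
    by (intro bexI[of _ \<psi>]) simp_all
qed

end

section \<open>Classification\<close>

lemma (in factor_pair) KX_factor_system:
  shows "(\<lambda>g\<in>carrier G. monom G B g \<one>\<^bsub>B\<^esub>) \<in> sections G KX"
    and "factor_system G B KX (\<lambda>g\<in>carrier G. monom G B g \<one>\<^bsub>B\<^esub>) = (S, \<omega>)"
proof -
  let ?\<sigma> = "\<lambda>g\<in>carrier G. monom G B g \<one>\<^bsub>B\<^esub>"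
  show s: "?\<sigma> \<in> sections G KX"
    using monom_Units by (auto simp: sections_def K_one)
  interpret T: crossed_product_section G B KX ?\<sigma>
    by unfold_locales (rule KX_crossed_product, rule s)
  show "factor_system G B KX ?\<sigma> = (S, \<omega>)"
  proof (rule T.factor_system_eqI)
    show "S \<in> extensional (carrier G)" "\<omega> \<in> extensional (carrier G \<times> carrier G)"
      using Z2 by (auto simp: Z2_iff PiE_iff)
    show "S g \<in> extensional (carrier B)" if "g \<in> carrier G" for g
      using Z2 that by (auto simp: Z2_iff PiE_iff)
  qed (simp_all add: K_monom_mult)
qed

section \<open>Equivalence of crossed products\<close>

lemma cp_equiv_sym:
  assumes X: "X \<in> crossed_products G B" and e: "cp_equiv G B X Y"
  shows "cp_equiv G B Y X"
proof -
  have alg: "complex_algebra (total X)" and b: "base X \<in> alg_hom B (total X)"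
    and d: "direct_sum_decomp (total X) (carrier G) (component X)"
    using X by (auto simp: crossed_products_def)
  interpret A: complex_algebra "total X" by (rule alg)
  obtain \<phi> where \<phi>: "\<phi> \<in> alg_iso (total X) (total Y)"
    and c: "\<forall>g\<in>carrier G. \<phi> ` component X g = component Y g"
    and base: "\<forall>b\<in>carrier B. \<phi> (base X b) = base Y b"
    using e unfolding cp_equiv_def by blast
  let ?\<phi> = "inv_into (carrier (total X)) \<phi>"
  have inj: "inj_on \<phi> (carrier (total X))" by (rule alg_isoD[OF \<phi>])
  have "?\<phi> ` component Y g = component X g" if g: "g \<in> carrier G" for g
  proof -
    have "component X g \<subseteq> carrier (total X)"
      using d g A.submoduleE(1) by (auto simp: direct_sum_decomp_def)
    then show ?thesis
      using inv_into_image_cancel[OF inj] c g by metis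
  qed
  moreover have "?\<phi> (base Y b) = base X b" if "b \<in> carrier B" for b
    using base that inj alg_hom_simps(1)[OF b] by (metis inv_into_f_f)
  ultimately show ?thesis
    unfolding cp_equiv_def using alg_iso_inv[OF \<phi> alg] by blast
qed

lemma cp_equiv_trans:
  assumes "cp_equiv G B X Y" "cp_equiv G B Y Z"
  shows "cp_equiv G B X Z"
proof -
  obtain \<phi> where \<phi>: "\<phi> \<in> alg_iso (total X) (total Y)"
    "\<forall>g\<in>carrier G. \<phi> ` component X g = component Y g" "\<forall>b\<in>carrier B. \<phi> (base X b) = base Y b"
    using assms(1) unfolding cp_equiv_def by blast
  obtain \<phi>' where \<phi>': "\<phi>' \<in> alg_iso (total Y) (total Z)"
    "\<forall>g\<in>carrier G. \<phi>' ` component Y g = component Z g" "\<forall>b\<in>carrier B. \<phi>' (base Y b) = base Z b"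
    using assms(2) unfolding cp_equiv_def by blast
  show ?thesis
    unfolding cp_equiv_def
  proof (intro bexI[of _ "\<phi>' \<circ> \<phi>"] conjI ballI)
    show "\<phi>' \<circ> \<phi> \<in> alg_iso (total X) (total Z)"
      using \<phi>(1) \<phi>'(1) by (rule alg_iso_comp)
    show "(\<phi>' \<circ> \<phi>) ` component X g = component Z g" if "g \<in> carrier G" for g
      unfolding image_comp[symmetric] using \<phi>(2) \<phi>'(2) that by simp
  qed (use \<phi>(3) \<phi>'(3) in simp)
qed

lemma cp_equiv_refl: "cp_equiv G B X X"
  unfolding cp_equiv_def using alg_iso_id by (intro bexI[of _ id]) auto

section \<open>The characteristic class as a set of factor systems\<close>

context group_alg
begin

text \<open>Composing \<open>\<sigma>\<close> with the isomorphism gives a section of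
  \<open>Y\<close>, and because the isomorphism respects the copies of \<open>B\<close>, it carries
  the equations characterising the factor system to the same equations in \<open>Y\<close>. The
  reverse inclusion comes from the inverse equivalence.\<close>

lemma factor_systems_mono:
  fixes X :: "('g, 'b, 'a) graded_alg" and Y :: "('g, 'b, 'c) graded_alg"
  assumes X: "X \<in> crossed_products G B" and Y: "Y \<in> crossed_products G B"
    and e: "cp_equiv G B X Y"
  shows "factor_system G B X ` sections G X \<subseteq> factor_system G B Y ` sections G Y"
proof (rule image_subsetI)
  fix \<sigma> assume \<sigma>: "\<sigma> \<in> sections G X"
  interpret X: crossed_product_section G B X \<sigma>
    by unfold_locales (rule X, rule \<sigma>)
  interpret Y: crossed_product G B Y
    by unfold_locales (rule Y)
  obtain \<phi> where \<phi>: "\<phi> \<in> alg_iso (total X) (total Y)"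
    and c: "\<forall>g\<in>carrier G. \<phi> ` component X g = component Y g"
    and base: "\<forall>b\<in>carrier B. \<phi> (base X b) = base Y b"
    using e unfolding cp_equiv_def by blast
  note hom = alg_isoD(1)[OF \<phi>]
  let ?\<tau> = "\<lambda>g\<in>carrier G. \<phi> (\<sigma> g)"
  have "\<phi> (\<sigma> g) \<in> component Y g" if "g \<in> carrier G" for g
    using c that X.\<sigma>_simps(1)[OF that] by blast
  then have \<tau>: "?\<tau> \<in> sections G Y"
    using alg_hom_Units[OF hom] alg_hom_simps(4)[OF hom] by (auto simp: sections_def)
  interpret T: crossed_product_section G B Y ?\<tau>
    by unfold_locales (rule \<tau>)
  have "factor_system G B Y ?\<tau> = (X.S, X.\<omega>)"
  proof (rule T.factor_system_eqI)
    show "X.S \<in> extensional (carrier G)" "X.\<omega> \<in> extensional (carrier G \<times> carrier G)"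
      using X.factor_system_Z2 by (auto simp: Z2_iff PiE_iff)
    show "X.S g \<in> extensional (carrier B)" if "g \<in> carrier G" for g
      using X.factor_system_Z2 that by (auto simp: Z2_iff PiE_iff)
  next
    fix g b assume g: "g \<in> carrier G" and b: "b \<in> carrier B"
    show "X.S g b \<in> carrier B" using X.S_base(1)[OF g b] .
    then have "base Y (X.S g b) \<otimes>\<^bsub>total Y\<^esub> ?\<tau> g = \<phi> (base X (X.S g b) \<otimes>\<^bsub>total X\<^esub> \<sigma> g)"
      using g base by (simp add: alg_hom_simps[OF hom])
    also have "\<dots> = ?\<tau> g \<otimes>\<^bsub>total Y\<^esub> base Y b"
      using g b base by (simp add: X.S_base(3) alg_hom_simps[OF hom])
    finally show "base Y (X.S g b) \<otimes>\<^bsub>total Y\<^esub> ?\<tau> g = ?\<tau> g \<otimes>\<^bsub>total Y\<^esub> base Y b" .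
  next
    fix g h assume g: "g \<in> carrier G" "h \<in> carrier G"
    show w: "X.\<omega> (g, h) \<in> carrier B" using g by simp
    then have "base Y (X.\<omega> (g, h)) \<otimes>\<^bsub>total Y\<^esub> ?\<tau> (g \<otimes>\<^bsub>G\<^esub> h)
        = \<phi> (base X (X.\<omega> (g, h)) \<otimes>\<^bsub>total X\<^esub> \<sigma> (g \<otimes>\<^bsub>G\<^esub> h))"
      using g base by (simp add: alg_hom_simps[OF hom])
    also have "\<dots> = ?\<tau> g \<otimes>\<^bsub>total Y\<^esub> ?\<tau> h"
      using g by (simp add: X.\<omega>_base(2) alg_hom_simps[OF hom])
    finally show "base Y (X.\<omega> (g, h)) \<otimes>\<^bsub>total Y\<^esub> ?\<tau> (g \<otimes>\<^bsub>G\<^esub> h)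
        = ?\<tau> g \<otimes>\<^bsub>total Y\<^esub> ?\<tau> h" .
  qed
  then have "factor_system G B X \<sigma> = factor_system G B Y ?\<tau>"
    by (simp add: X.factor_system_eq)
  with \<tau> show "factor_system G B X \<sigma> \<in> factor_system G B Y ` sections G Y"
    by blast
qed

text \<open>The results about one fixed section, restated for arbitrary \<open>X\<close> and
  \<open>\<sigma>\<close> so that several crossed products can be compared.\<close>

lemma factor_system_class:
  assumes X: "X \<in> crossed_products G B" and \<sigma>: "\<sigma> \<in> sections G X"
  shows "factor_system G B X \<sigma> \<in> Z2 G B"
    and "coh_class G B (factor_system G B X \<sigma>) = factor_system G B X ` sections G X"
    and "case factor_system G B X \<sigma> of (S, \<omega>) \<Rightarrow> cp_equiv G B (twisted_cp G B S \<omega>) X"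
proof -
  interpret X: crossed_product_section G B X \<sigma>
    by unfold_locales (rule X, rule \<sigma>)
  show "factor_system G B X \<sigma> \<in> Z2 G B"
    using X.factor_system_Z2 by (simp add: X.factor_system_eq)
  show "coh_class G B (factor_system G B X \<sigma>) = factor_system G B X ` sections G X"
    by (rule X.coh_class_eq)
  show "case factor_system G B X \<sigma> of (S, \<omega>) \<Rightarrow> cp_equiv G B (twisted_cp G B S \<omega>) X"
    using X.twisted_cp_equiv by (simp add: X.factor_system_eq)
qed

lemma crossed_product_sections_nonempty:
  assumes "X \<in> crossed_products G B"
  shows "sections G X \<noteq> {}"
proof -
  interpret crossed_product G B X by unfold_locales (rule assms)
  show ?thesis by (rule sections_nonempty)
qed

text \<open>All sections yield the same orbit, and there is at least one section; so
  \<open>the_elem\<close> is applied to a singleton.\<close>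

lemma char_class_eq:
  assumes X: "X \<in> crossed_products G B"
  shows "char_class G B X = factor_system G B X ` sections G X"
proof -
  have "(\<lambda>\<sigma>. coh_class G B (factor_system G B X \<sigma>)) ` sections G X
      = {factor_system G B X ` sections G X}"
    using factor_system_class(2)[OF X] crossed_product_sections_nonempty[OF X] by auto
  then show ?thesis by (simp add: char_class_def)
qed

lemma char_class_cong:
  assumes "X \<in> crossed_products G B" "Y \<in> crossed_products G B" "cp_equiv G B X Y"
  shows "char_class G B X = char_class G B Y"
  using factor_systems_mono assms cp_equiv_sym by (metis char_class_eq subset_antisym)

lemma twisted_cp_crossed_product:
  "(S, \<omega>) \<in> Z2 G B \<Longrightarrow> twisted_cp G B S \<omega> \<in> crossed_products G B"
  by (intro factor_pair.KX_crossed_product factor_pair.intro factor_pair_axioms.intro group_alg_axioms)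

text \<open>Besides serving injectivity, this moves a crossed product of any carrier type to the
  type \<open>'g \<Rightarrow> 'b\<close>.\<close>

lemma equiv_twisted_cp:
  assumes X: "X \<in> crossed_products G B"
  obtains S \<omega> where "(S, \<omega>) \<in> Z2 G B" "(S, \<omega>) \<in> char_class G B X"
    "twisted_cp G B S \<omega> \<in> crossed_products G B" "cp_equiv G B X (twisted_cp G B S \<omega>)"
proof -
  obtain \<sigma> where \<sigma>: "\<sigma> \<in> sections G X" using crossed_product_sections_nonempty[OF X] by blast
  obtain S \<omega> where eq: "factor_system G B X \<sigma> = (S, \<omega>)" by fastforce
  note z = factor_system_class[OF X \<sigma>, unfolded eq prod.case]
  show ?thesis
  proof
    show "(S, \<omega>) \<in> char_class G B X"
      unfolding char_class_eq[OF X] using eq \<sigma> by (metis image_eqI)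
    show "cp_equiv G B X (twisted_cp G B S \<omega>)"
      by (rule cp_equiv_sym[OF twisted_cp_crossed_product]) (rule z)+
  qed (rule z twisted_cp_crossed_product)+
qed

text \<open>Equality of the classes as sets provides a factor system common to \<open>X\<close> and
  \<open>Y\<close>; its twisted algebra is the link between them.\<close>

lemma cp_equiv_if_char_class_eq:
  assumes X: "X \<in> crossed_products G B" and Y: "Y \<in> crossed_products G B"
    and eq: "char_class G B X = char_class G B Y"
  shows "cp_equiv G B X Y"
proof -
  obtain S \<omega> where z: "(S, \<omega>) \<in> char_class G B X" "cp_equiv G B X (twisted_cp G B S \<omega>)"
    using equiv_twisted_cp[OF X] by blast
  then obtain \<tau> where "\<tau> \<in> sections G Y" "factor_system G B Y \<tau> = (S, \<omega>)"
    using eq char_class_eq[OF Y] by auto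
  then have "cp_equiv G B (twisted_cp G B S \<omega>) Y"
    using factor_system_class(3)[OF Y] by fastforce
  with z(2) show ?thesis by (rule cp_equiv_trans)
qed

text \<open>The source of surjectivity: the orbit of a factor system is the class of its own twisted
  algebra.\<close>

lemma char_class_twisted_cp:
  assumes "(S, \<omega>) \<in> Z2 G B"
  shows "char_class G B (twisted_cp G B S \<omega>) = coh_class G B (S, \<omega>)"
proof -
  interpret factor_pair G B S \<omega> by unfold_locales (rule assms)
  show ?thesis
    using factor_system_class(2)[OF KX_crossed_product KX_factor_system(1)]
    by (simp add: char_class_eq[OF KX_crossed_product] KX_factor_system(2))
qed

lemma H2_eq: "H2 G B = coh_class G B ` Z2 G B"
  unfolding H2_def orbits_def coh_class_def by auto

lemma ext_rel_equiv: "equiv (crossed_products G B) (ext_rel G B)"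
proof (rule equivI)
  show "ext_rel G B \<subseteq> crossed_products G B \<times> crossed_products G B"
    by (auto simp: ext_rel_def)
  show "refl_on (crossed_products G B) (ext_rel G B)"
    by (auto simp: ext_rel_def refl_on_def cp_equiv_refl)
  show "sym (ext_rel G B)"
    by (auto simp: ext_rel_def cp_equiv_sym intro!: symI)
  show "trans (ext_rel G B)"
    by (auto simp: ext_rel_def intro!: transI intro: cp_equiv_trans)
qed

lemma char_map_eq:
  assumes X: "X \<in> crossed_products G B"
  shows "char_map G B (ext_rel G B `` {X}) = char_class G B X"
proof -
  have "char_class G B ` (ext_rel G B `` {X}) = {char_class G B X}"
    using X char_class_cong[OF X] cp_equiv_refl[of G B X]
    by (auto simp: ext_rel_def intro!: image_eqI[of _ _ X])
  then show ?thesis by (simp add: char_map_def)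
qed

text \<open>The carrier type is that of the twisted algebras, so every orbit has a crossed product
  realising it within this same \<open>Ext\<close>.\<close>

lemma char_map_bij:
  "bij_betw (char_map G B) (Ext G B :: ('g, 'b, 'g \<Rightarrow> 'b) graded_alg set set) (H2 G B)"
proof (rule bij_betw_imageI)
  let ?C = "crossed_products G B :: ('g, 'b, 'g \<Rightarrow> 'b) graded_alg set"
  show "inj_on (char_map G B) (Ext G B :: ('g, 'b, 'g \<Rightarrow> 'b) graded_alg set set)"
  proof (rule inj_onI)
    fix E F :: "('g, 'b, 'g \<Rightarrow> 'b) graded_alg set"
    assume E: "E \<in> Ext G B" and F: "F \<in> Ext G B" and eq: "char_map G B E = char_map G B F"
    obtain X where X: "X \<in> ?C" "E = ext_rel G B `` {X}"
      using E unfolding Ext_def by (rule quotientE)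
    obtain Y where Y: "Y \<in> ?C" "F = ext_rel G B `` {Y}"
      using F unfolding Ext_def by (rule quotientE)
    have "cp_equiv G B X Y"
      using cp_equiv_if_char_class_eq X Y eq char_map_eq by metis
    then have "(X, Y) \<in> ext_rel G B"
      using X Y by (simp add: ext_rel_def)
    then show "E = F"
      unfolding X Y by (rule equiv_class_eq[OF ext_rel_equiv])
  qed
  have "char_map G B ` (Ext G B :: ('g, 'b, 'g \<Rightarrow> 'b) graded_alg set set) = char_class G B ` ?C"
    unfolding Ext_def quotient_def UNION_singleton_eq_range image_image
    by (intro image_cong) (simp_all add: char_map_eq)
  also have "\<dots> = coh_class G B ` Z2 G B"
  proof (intro equalityI image_subsetI)
    fix X assume X: "X \<in> ?C"
    obtain \<sigma> where \<sigma>: "\<sigma> \<in> sections G X" using crossed_product_sections_nonempty[OF X] by blast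
    show "char_class G B X \<in> coh_class G B ` Z2 G B"
      using factor_system_class(1,2)[OF X \<sigma>] char_class_eq[OF X] by (metis image_eqI)
  next
    fix z assume "z \<in> Z2 G B"
    then show "coh_class G B z \<in> char_class G B ` ?C"
      using char_class_twisted_cp twisted_cp_crossed_product by (cases z) (metis image_eqI)
  qed
  finally show "char_map G B ` (Ext G B :: ('g, 'b, 'g \<Rightarrow> 'b) graded_alg set set) = H2 G B"
    by (simp add: H2_eq)
qed

end

theorem theoremA15:
  fixes G :: "('g, 'm) monoid_scheme"
    and B :: "(complex, 'b, 'n) module_scheme"
  assumes "group G" and "complex_algebra B"
  shows
    \<comment> \<open>the class does not depend on the choice of \<open>\<sigma>\<close>\<close>
    "(\<forall>X \<in> (crossed_products G B :: ('g, 'b, 'a) graded_alg set).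
        sections G X \<noteq> {} \<and>
        (\<forall>\<sigma>\<in>sections G X. factor_system G B X \<sigma> \<in> Z2 G B \<and>
          char_class G B X = coh_class G B (factor_system G B X \<sigma>)))
    \<comment> \<open>it depends only on the equivalence class, also across different carrier types\<close>
    \<and> (\<forall>X \<in> (crossed_products G B :: ('g, 'b, 'a) graded_alg set).
        \<forall>Y \<in> (crossed_products G B :: ('g, 'b, 'c) graded_alg set).
        cp_equiv G B X Y \<longrightarrow> char_class G B X = char_class G B Y)
    \<and> equiv (crossed_products G B) (ext_rel G B :: ('g, 'b, 'a) graded_alg rel)
    \<and> (\<forall>X \<in> (crossed_products G B :: ('g, 'b, 'a) graded_alg set).
        char_map G B (ext_rel G B `` {X}) = char_class G B X)
    \<comment> \<open>every crossed product is equivalent to one carried by the type \<open>'g \<Rightarrow> 'b\<close>,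
       so classes over this type represent all of Ext\<close>
    \<and> (\<forall>X \<in> (crossed_products G B :: ('g, 'b, 'a) graded_alg set).
        \<exists>Y \<in> (crossed_products G B :: ('g, 'b, 'g \<Rightarrow> 'b) graded_alg set). cp_equiv G B X Y)
    \<and> bij_betw (char_map G B) (Ext G B :: ('g, 'b, 'g \<Rightarrow> 'b) graded_alg set set) (H2 G B)"
proof -
  interpret group_alg G B using assms by (rule group_alg.intro)
  show ?thesis
  proof (intro conjI ballI impI)
    fix X :: "('g, 'b, 'a) graded_alg" assume X: "X \<in> crossed_products G B"
    show "sections G X \<noteq> {}"
      by (rule crossed_product_sections_nonempty[OF X])
    show "char_map G B (ext_rel G B `` {X}) = char_class G B X"
      by (rule char_map_eq[OF X])
    show "\<exists>Y \<in> (crossed_products G B :: ('g, 'b, 'g \<Rightarrow> 'b) graded_alg set). cp_equiv G B X Y"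
      using equiv_twisted_cp[OF X] by blast
    show "factor_system G B X \<sigma> \<in> Z2 G B" if "\<sigma> \<in> sections G X" for \<sigma>
      by (rule factor_system_class[OF X that])
    show "char_class G B X = coh_class G B (factor_system G B X \<sigma>)" if "\<sigma> \<in> sections G X" for \<sigma>
      by (simp add: char_class_eq[OF X] factor_system_class(2)[OF X that])
    show "char_class G B X = char_class G B Y"
      if "Y \<in> crossed_products G B" "cp_equiv G B X Y" for Y :: "('g, 'b, 'c) graded_alg"
      by (rule char_class_cong[OF X that])
  qed (rule ext_rel_equiv char_map_bij)+
qed

end
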